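(* Let $\bm y\in\mathbb{R}^d$, let $\bm\alpha\in\mathbb{N}^d$ and let $h_{k,\bm\alpha}$ be the harmonic homogeneous polynomials of degree $|\bm\alpha|-2k$, $k\in\mathbb{N}$, $2k\le |\bm\alpha|$, implicitly (and uniquely) defined by $$ \bm y^{\bm\alpha} = \sum_{k=0}^{\lfloor |\bm\alpha|/2\rfloor} |\bm y|^{2k}h_{k,\bm\alpha}(\bm y),\qquad \bm y \in\mathbb{R}^d. $$ Then the harmonic polynomials admit the representation $$ h_{k,\bm\alpha}(\bm y)= \omega_{k,|\bm\alpha|} \sum_{\substack{\bm\gamma\in\mathbb{N}^d\\ 2\bm\gamma\ge\bm\alpha \\ |\bm\gamma|=|\bm\alpha|-k }} c_{k,\bm\alpha,\bm\gamma} \; \bm y^{2\bm\gamma-\bm\alpha}. $$ Here, the coefficients are the dyadic rationals $$ c_{k,\bm\alpha,\bm\gamma} = \sum_{\substack{ \bm\beta\in\mathbb{N}^d \\ \bm 0 \le \bm\alpha+\bm\beta-\bm\gamma \le \bm\alpha/2 }} (-2)^{-|\bm\beta|} \, (\bm\gamma-\bm\beta)_{\bm\alpha+\bm\beta-\bm\gamma} \, q_{k,|\bm\alpha|,|\bm\beta|} \, \frac{|\bm\beta|!}{\bm\beta!} \binom{|\bm\beta|+k}{k} \binom{\bm\alpha}{\bm\alpha+\bm\beta-\bm\gamma}, $$ and the global constant is defined by $$ \frac{1}{\omega_{k,n}} = 2^k q_{k,n,0}\prod_{j=1}^k (2n+d-2k-2j) $$ for $n\in\mathbb{N}$, $n\ge2k$,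 where $$ q_{k,n,m} = \prod_{j=m+1}^{\lfloor n/2\rfloor -k}(2n+d-2-4k-2j) $$ for $m\in\mathbb{N}$, $m\le \lfloor n/2\rfloor -k$.
   Context: $\mathbb{N}=\{0,1,2,\dots\}$, $d\ge 1$ is an integer, $0^0=1$, empty products equal $1$ and empty sums equal $0$. A polynomial $h$ on $\mathbb{R}^d$ is harmonic if $\Delta h=0$. For multi-indices $\bm\alpha,\bm\beta\in\mathbb{N}^d$: $|\bm\alpha|=\sum_j\alpha^{(j)}$, $\bm\alpha!=\prod_j\alpha^{(j)}!$, $\bm y^{\bm\alpha}=\prod_j(y^{(j)})^{\alpha^{(j)}}$, inequalities are componentwise, $\binom{\bm\alpha}{\bm\beta}=\prod_j\binom{\alpha^{(j)}}{\beta^{(j)}}$, and $(\bm\alpha)_{\bm\beta}=\prod_j(\alpha^{(j)})_{\beta^{(j)}}$ with the falling Pochhammer symbol $(a)_k=a(a-1)\cdots(a-k+1)$, $(a)_0=1$. $|\bm y|$ is the Euclidean norm of a vector $\bm y\in\mathbb{R}^d$. A dyadic rational is a rational number of the form $a/2^b$ with $a\in\mathbb{Z}$, $b\in\mathbb{N}$. *)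

theory Defs
  imports "HOL-Analysis.Analysis"
begin

text \<open>
  The dimension is \<open>d = CARD('n)\<close>; points of \<open>d\<close>-space have type \<open>real ^ 'n\<close> and multi-indices
  have type \<open>nat ^ 'n\<close>, with the componentwise \<open>+\<close>, \<open>-\<close> and \<open>\<le>\<close> of the library.
  Subtraction on \<open>nat ^ 'n\<close> truncates, so below it is applied only where the difference is
  nonnegative in each component.
\<close>

definition mi_size :: "nat ^ 'n::finite \<Rightarrow> nat" where
  "mi_size \<alpha> = (\<Sum>i\<in>UNIV. \<alpha> $ i)"

definition mi_fact :: "nat ^ 'n::finite \<Rightarrow> real" where
  "mi_fact \<alpha> = (\<Prod>i\<in>UNIV. fact (\<alpha> $ i))"

definition mi_power :: "real ^ 'n::finite \<Rightarrow> nat ^ 'n \<Rightarrow> real" where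
  "mi_power y \<alpha> = (\<Prod>i\<in>UNIV. (y $ i) ^ (\<alpha> $ i))"

definition mi_binomial :: "nat ^ 'n::finite \<Rightarrow> nat ^ 'n \<Rightarrow> real" where
  "mi_binomial \<alpha> \<beta> = (\<Prod>i\<in>UNIV. real ((\<alpha> $ i) choose (\<beta> $ i)))"

text \<open>The library's \<^const>\<open>pochhammer\<close> is the rising factorial; here the falling one is needed.\<close>

definition falling :: "real \<Rightarrow> nat \<Rightarrow> real" where
  "falling a k = (\<Prod>i<k. a - real i)"

definition mi_falling :: "real ^ 'n::finite \<Rightarrow> nat ^ 'n \<Rightarrow> real" where
  "mi_falling a \<beta> = (\<Prod>i\<in>UNIV. falling (a $ i) (\<beta> $ i))"

definition mi_real :: "nat ^ 'n::finite \<Rightarrow> real ^ 'n" where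
  "mi_real \<alpha> = (\<chi> i. real (\<alpha> $ i))"

text \<open>
  Polynomials are identified with the functions they induce; the zero polynomial is homogeneous
  of every degree. The index set of the sum is finite.
\<close>

definition homogeneous_polynomial :: "nat \<Rightarrow> (real ^ 'n::finite \<Rightarrow> real) \<Rightarrow> bool" where
  "homogeneous_polynomial m h \<longleftrightarrow>
     (\<exists>a :: nat ^ 'n \<Rightarrow> real. \<forall>y. h y = (\<Sum>\<mu> | mi_size \<mu> = m. a \<mu> * mi_power y \<mu>))"

text \<open>Each summand is the second partial derivative of \<open>h\<close> at \<open>y\<close> in coordinate \<open>i\<close>.\<close>

definition laplacian :: "(real ^ 'n::finite \<Rightarrow> real) \<Rightarrow> real ^ 'n \<Rightarrow> real" where
  "laplacian h y = (\<Sum>i\<in>UNIV. (deriv ^^ 2) (\<lambda>t. h (y + t *\<^sub>R axis i 1)) 0)"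

definition is_harmonic :: "(real ^ 'n::finite \<Rightarrow> real) \<Rightarrow> bool" where
  "is_harmonic h \<longleftrightarrow> (\<forall>y. laplacian h y = 0)"

text \<open>
  Only the values \<open>h k\<close> with \<open>2 * k \<le> mi_size \<alpha>\<close> are constrained here.
\<close>

definition harmonic_decomposition ::
    "nat ^ 'n::finite \<Rightarrow> (nat \<Rightarrow> real ^ 'n \<Rightarrow> real) \<Rightarrow> bool" where
  "harmonic_decomposition \<alpha> h \<longleftrightarrow>
     (\<forall>k. 2 * k \<le> mi_size \<alpha> \<longrightarrow>
        homogeneous_polynomial (mi_size \<alpha> - 2 * k) (h k) \<and> is_harmonic (h k)) \<and>
     (\<forall>y. mi_power y \<alpha> = (\<Sum>k = 0..mi_size \<alpha> div 2. norm y ^ (2 * k) * h k y))"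

text \<open>
  In the next two definitions the first argument \<open>d\<close> is the dimension. The factors are formed in
  the reals. The intended ranges are \<open>2 * k \<le> n\<close> and \<open>m \<le> n div 2 - k\<close>.
\<close>

definition q_prod :: "nat \<Rightarrow> nat \<Rightarrow> nat \<Rightarrow> nat \<Rightarrow> real" where
  "q_prod d k n m =
     (\<Prod>j = m + 1..n div 2 - k. 2 * real n + real d - 2 - 4 * real k - 2 * real j)"

definition omega :: "nat \<Rightarrow> nat \<Rightarrow> nat \<Rightarrow> real" where
  "omega d k n =
     1 / (2 ^ k * q_prod d k n 0 * (\<Prod>j = 1..k. 2 * real n + real d - 2 * real k - 2 * real j))"

text \<open>
  The two conditions on \<open>\<beta>\<close> say \<open>0 \<le> \<alpha> + \<beta> - \<gamma> \<le> \<alpha> / 2\<close> componentwise. For \<open>\<gamma>\<close> with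
  \<open>mi_size \<gamma> = mi_size \<alpha> - k\<close> they force \<open>mi_size \<beta> \<le> mi_size \<alpha> div 2 - k\<close>, so
  \<^const>\<open>q_prod\<close> is used within its range.
\<close>

definition coeff_c :: "nat \<Rightarrow> nat ^ 'n::finite \<Rightarrow> nat ^ 'n \<Rightarrow> real" where
  "coeff_c k \<alpha> \<gamma> =
     (\<Sum>\<beta> | \<gamma> \<le> \<alpha> + \<beta> \<and> 2 * (\<alpha> + \<beta> - \<gamma>) \<le> \<alpha>.
        (- 2) powi (- int (mi_size \<beta>))
        * mi_falling (mi_real \<gamma> - mi_real \<beta>) (\<alpha> + \<beta> - \<gamma>)
        * q_prod CARD('n) k (mi_size \<alpha>) (mi_size \<beta>)
        * (fact (mi_size \<beta>) / mi_fact \<beta>)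
        * real ((mi_size \<beta> + k) choose k)
        * mi_binomial \<alpha> (\<alpha> + \<beta> - \<gamma>))"

text \<open>The library's \<^const>\<open>dyadics\<close> contains only the nonnegative ones.\<close>

definition dyadic_rational :: "real \<Rightarrow> bool" where
  "dyadic_rational x \<longleftrightarrow> (\<exists>(a::int) (b::nat). x = of_int a / 2 ^ b)"

end

theory Submission
  imports Defs
begin

text \<open>
  Write \<open>\<Delta>\<close> for the Laplacian. From \<open>\<Delta>(|y|\<^sup>2 f) = |y|\<^sup>2 \<Delta>f + (4m + 2d) f\<close> for \<open>f\<close> homogeneous of
  degree \<open>m\<close>, the operator \<open>f \<mapsto> \<Sum>\<^sub>b c\<^sub>b |y|\<^bsup>2b\<^esup> \<Delta>\<^sup>b f\<close> with suitable constants \<open>c\<^sub>b\<close> has harmonic values, by a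
  telescoping sum, and maps \<open>f\<close> to \<open>c\<^sub>0 f\<close> modulo multiples of \<open>|y|\<^sup>2\<close>; as \<open>c\<^sub>0 \<noteq> 0\<close>, the decomposition
  exists by induction on the degree. The operator vanishes on multiples of \<open>|y|\<^sup>2\<close>, since no nonzero
  harmonic polynomial is one, and \<open>\<Delta>\<^sup>k\<close> maps \<open>\<Sum>\<^sub>l |y|\<^bsup>2l\<^esup> h\<^sub>l\<close> to a nonzero constant times \<open>h\<^sub>k\<close> modulo
  multiples of \<open>|y|\<^sup>2\<close>. So \<open>h\<^sub>k\<close> is a known multiple of the projection of \<open>\<Delta>\<^sup>k y\<^sup>\<alpha>\<close>. Expanding \<open>|y|\<^bsup>2b\<^esup>\<close> and
  \<open>\<Delta>\<^bsup>b+k\<^esup>\<close> by the multinomial theorem, with multi-indices \<open>\<beta>\<close> and \<open>\<delta>\<close>, gives the formula after the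
  substitution \<open>\<gamma> = \<alpha> + \<beta> - \<delta>\<close>.
\<close>

subsection \<open>Multi-indices and monomials\<close>

text \<open>No component can exceed the size. Finiteness matters because a sum over an infinite set
  is 0 by default.\<close>

lemma finite_mi_size [simp]: "finite {\<mu> :: nat ^ 'n::finite. mi_size \<mu> = m}"
proof (rule finite_subset)
  show "{\<mu> :: nat ^ 'n. mi_size \<mu> = m} \<subseteq> vec_lambda ` (PiE UNIV (\<lambda>_. {..m}))"
  proof
    fix \<mu> :: "nat ^ 'n" assume "\<mu> \<in> {\<mu>. mi_size \<mu> = m}"
    then have "\<mu> $ i \<le> m" for i
      unfolding mi_size_def using member_le_sum[of i UNIV "\<lambda>i. \<mu> $ i"] by simp
    then show "\<mu> \<in> vec_lambda ` (PiE UNIV (\<lambda>_. {..m}))"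
      by (intro image_eqI[of _ _ "vec_nth \<mu>"]) auto
  qed
qed (auto intro!: finite_imageI finite_PiE)

lemma sum_axis: "(\<Sum>i\<in>UNIV. (axis j c :: nat ^ 'n::finite) $ i) = c"
  by (simp add: axis_def)

lemma mi_size_add [simp]: "mi_size (\<mu> + \<nu>) = mi_size \<mu> + mi_size \<nu>"
  by (simp add: mi_size_def sum.distrib)

lemma mi_size_axis [simp]: "mi_size (axis i c) = c"
  by (simp add: mi_size_def sum_axis)

lemma mi_size_double [simp]: "mi_size (2 * \<mu>) = 2 * mi_size \<mu>"
  by (simp add: mi_size_def sum_distrib_left)

lemma mi_size_diff: "\<nu> \<le> \<mu> \<Longrightarrow> mi_size (\<mu> - \<nu>) = mi_size \<mu> - mi_size \<nu>"
  by (simp add: mi_size_def less_eq_vec_def sum_subtractf_nat)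

lemma mi_power_add: "mi_power y (\<mu> + \<nu>) = mi_power y \<mu> * mi_power y \<nu>"
  by (simp add: mi_power_def power_add prod.distrib)

lemma mi_power_axis: "mi_power y (axis i c) = y $ i ^ c"
proof -
  have "mi_power y (axis i c) = (\<Prod>j\<in>UNIV. if j = i then y $ i ^ c else 1)"
    unfolding mi_power_def by (intro prod.cong) (auto simp: axis_def)
  then show ?thesis by simp
qed

text \<open>Isolates the only coordinate that depends on \<open>t\<close>, so that partial
  derivatives of monomials become derivatives of one-variable powers.\<close>

lemma mi_power_update:
  "mi_power (y + t *\<^sub>R axis i 1) \<mu> = (\<Prod>j\<in>UNIV - {i}. y $ j ^ (\<mu> $ j)) * (y $ i + t) ^ (\<mu> $ i)"
  unfolding mi_power_def
  by (subst prod.remove[of _ i]) (auto simp: axis_def mult.commute intro!: prod.cong)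

lemma norm_power2_sum: "norm (y :: real ^ 'n::finite) ^ 2 = (\<Sum>i\<in>UNIV. mi_power y (axis i 2))"
  unfolding power2_norm_eq_inner inner_vec_def by (simp add: mi_power_axis power2_eq_square)

subsection \<open>The Laplacian on homogeneous polynomials\<close>

text \<open>The index family is arbitrary because later sums run over pairs or over truncated
  exponents and need not list distinct monomials. Truncation in \<open>\<nu> s - axis i 2\<close> is
  harmless: the coefficient vanishes when the exponent is below 2.\<close>

lemma laplacian_sum_monomials:
  fixes \<nu> :: "'s \<Rightarrow> nat ^ 'n::finite"
  shows "laplacian (\<lambda>y. \<Sum>s\<in>A. a s * mi_power y (\<nu> s)) y =
    (\<Sum>s\<in>A. a s * (\<Sum>i\<in>UNIV. real (\<nu> s $ i) * real (\<nu> s $ i - 1) * mi_power y (\<nu> s - axis i 2)))"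
proof -
  have "(deriv ^^ 2) (\<lambda>t. \<Sum>s\<in>A. a s * mi_power (y + t *\<^sub>R axis i 1) (\<nu> s)) 0 =
      (\<Sum>s\<in>A. a s * (real (\<nu> s $ i) * real (\<nu> s $ i - 1) * mi_power y (\<nu> s - axis i 2)))" for i
  proof -
    define C where "C s = (\<Prod>j\<in>UNIV - {i}. y $ j ^ (\<nu> s $ j))" for s
    have 1: "(\<lambda>t. \<Sum>s\<in>A. a s * mi_power (y + t *\<^sub>R axis i 1) (\<nu> s)) =
        (\<lambda>t. \<Sum>s\<in>A. a s * (C s * (y $ i + t) ^ (\<nu> s $ i)))"
      by (simp add: mi_power_update C_def)
    have 2: "deriv (\<lambda>t. \<Sum>s\<in>A. a s * (C s * (y $ i + t) ^ (\<nu> s $ i))) =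
        (\<lambda>t. \<Sum>s\<in>A. a s * (C s * (real (\<nu> s $ i) * (y $ i + t) ^ (\<nu> s $ i - 1))))"
      by (rule ext, rule DERIV_imp_deriv) (auto intro!: derivative_eq_intros sum.cong)
    have 3: "deriv (\<lambda>t. \<Sum>s\<in>A. a s * (C s * (real (\<nu> s $ i) * (y $ i + t) ^ (\<nu> s $ i - 1)))) 0 =
        (\<Sum>s\<in>A. a s * (C s * (real (\<nu> s $ i) * (real (\<nu> s $ i - 1) * (y $ i + 0) ^ (\<nu> s $ i - 1 - 1)))))"
      by (rule DERIV_imp_deriv) (auto intro!: derivative_eq_intros sum.cong)
    \<comment> \<open>Subtracting 1 twice and subtracting 2 truncate in the same way.\<close>
    have 4: "C s * (y $ i + 0) ^ (\<nu> s $ i - 1 - 1) = mi_power y (\<nu> s - axis i 2)" for s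
      unfolding mi_power_def C_def
      by (subst (2) prod.remove[of _ i])
        (auto simp: axis_def mult.commute numeral_2_eq_2 intro!: prod.cong)
    have 5: "(deriv ^^ 2) g x = deriv (deriv g) x" for g and x :: real
      by (simp add: numeral_2_eq_2)
    show ?thesis
      unfolding 1 2 3 4[symmetric] 5 by (simp only: mult_ac)
  qed
  then show ?thesis
    unfolding laplacian_def by (simp add: sum.swap[of _ A] sum_distrib_left)
qed

section \<open>Linear combinations, and the degree drop under the Laplacian\<close>

lemma homogeneous_polynomial_lincomb:
  assumes "\<And>s. s \<in> A \<Longrightarrow> homogeneous_polynomial m (f s)"
  shows "homogeneous_polynomial m (\<lambda>y. \<Sum>s\<in>A. c s * f s y)"
proof -
  from assms obtain a where a: "\<And>s y. s \<in> A \<Longrightarrow> f s y = (\<Sum>\<mu> | mi_size \<mu> = m. a s \<mu> * mi_power y \<mu>)"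
    unfolding homogeneous_polynomial_def by metis
  have "(\<Sum>s\<in>A. c s * f s y) = (\<Sum>\<mu> | mi_size \<mu> = m. (\<Sum>s\<in>A. c s * a s \<mu>) * mi_power y \<mu>)" for y
    by (simp add: a sum_distrib_left sum_distrib_right sum.swap[of _ A] mult.assoc)
  then show ?thesis unfolding homogeneous_polynomial_def
    by (intro exI[of _ "\<lambda>\<mu>. \<Sum>s\<in>A. c s * a s \<mu>"]) blast
qed

text \<open>\<open>deriv\<close> is linear only where derivatives exist; homogeneity provides
  coefficients, on which linearity is a rearrangement of finite sums.\<close>

lemma laplacian_lincomb:
  assumes "\<And>s. s \<in> A \<Longrightarrow> homogeneous_polynomial m (f s)"
  shows "laplacian (\<lambda>y. \<Sum>s\<in>A. c s * f s y) = (\<lambda>y. \<Sum>s\<in>A. c s * laplacian (f s) y)"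
proof
  fix y
  from assms obtain a where a: "\<And>s y. s \<in> A \<Longrightarrow> f s y = (\<Sum>\<mu> | mi_size \<mu> = m. a s \<mu> * mi_power y \<mu>)"
    unfolding homogeneous_polynomial_def by metis
  have f: "f s = (\<lambda>y. \<Sum>\<mu> | mi_size \<mu> = m. a s \<mu> * mi_power y \<mu>)" if "s \<in> A" for s
    using a that by blast
  have "(\<Sum>s\<in>A. c s * f s y) = (\<Sum>\<mu> | mi_size \<mu> = m. (\<Sum>s\<in>A. c s * a s \<mu>) * mi_power y \<mu>)" for y
    by (simp add: a sum_distrib_left sum_distrib_right sum.swap[of _ A] mult.assoc)
  then have "laplacian (\<lambda>y. \<Sum>s\<in>A. c s * f s y) y =
      (\<Sum>\<mu> | mi_size \<mu> = m. (\<Sum>s\<in>A. c s * a s \<mu>) *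
        (\<Sum>i\<in>UNIV. real (\<mu> $ i) * real (\<mu> $ i - 1) * mi_power y (\<mu> - axis i 2)))"
    by (simp add: laplacian_sum_monomials[where \<nu>="\<lambda>\<mu>. \<mu>"])
  also have "\<dots> = (\<Sum>s\<in>A. c s * (\<Sum>\<mu> | mi_size \<mu> = m. a s \<mu> *
        (\<Sum>i\<in>UNIV. real (\<mu> $ i) * real (\<mu> $ i - 1) * mi_power y (\<mu> - axis i 2))))"
    unfolding sum_distrib_right sum.swap[of _ A] sum_distrib_left[of "c _"]
    by (simp add: mult.assoc)
  also have "\<dots> = (\<Sum>s\<in>A. c s * laplacian (f s) y)"
    by (intro sum.cong) (simp_all add: f laplacian_sum_monomials[where \<nu>="\<lambda>\<mu>. \<mu>"])
  finally show "laplacian (\<lambda>y. \<Sum>s\<in>A. c s * f s y) y = (\<Sum>s\<in>A. c s * laplacian (f s) y)" .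
qed

lemma homogeneous_polynomial_monomial:
  assumes "mi_size \<mu> = m"
  shows "homogeneous_polynomial m (\<lambda>y. mi_power y \<mu>)"
proof -
  have "mi_power y \<mu> = (\<Sum>\<nu> | mi_size \<nu> = m. of_bool (\<nu> = \<mu>) * mi_power y \<nu>)" for y
    using assms by (subst sum.mono_neutral_right[of _ "{\<mu>}"]) auto
  then show ?thesis unfolding homogeneous_polynomial_def
    by (intro exI[of _ "\<lambda>\<nu>. of_bool (\<nu> = \<mu>)"]) blast
qed

text \<open>Zero, scaling and addition are linear combinations over an empty, a one-element and a
  two-element index set.\<close>

lemma homogeneous_polynomial_zero: "homogeneous_polynomial m (\<lambda>_. 0)"
  using homogeneous_polynomial_lincomb[of "{}"] by simp

lemma homogeneous_polynomial_scale:
  "homogeneous_polynomial m f \<Longrightarrow> homogeneous_polynomial m (\<lambda>y. c * f y)"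
  using homogeneous_polynomial_lincomb[of "{()}" m "\<lambda>_. f" "\<lambda>_. c"] by simp

lemma homogeneous_polynomial_add:
  "homogeneous_polynomial m f \<Longrightarrow> homogeneous_polynomial m g \<Longrightarrow> homogeneous_polynomial m (\<lambda>y. f y + g y)"
  using homogeneous_polynomial_lincomb[of "UNIV :: bool set" m "\<lambda>b. if b then f else g" "\<lambda>_. 1"]
  by (simp add: UNIV_bool add.commute)

lemma laplacian_zero: "laplacian (\<lambda>_. 0) = (\<lambda>_. 0)"
  using laplacian_lincomb[of "{}"] by simp

lemma laplacian_scale:
  "homogeneous_polynomial m f \<Longrightarrow> laplacian (\<lambda>y. c * f y) = (\<lambda>y. c * laplacian f y)"
  using laplacian_lincomb[of "{()}" m "\<lambda>_. f" "\<lambda>_. c"] by simp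

text \<open>All exponents are at most 1, so every second partial derivative vanishes. This ends the
  telescoping sum and starts the inductions on the degree.\<close>

lemma homogeneous_polynomial_laplacian_low:
  assumes "homogeneous_polynomial m f" "m < 2"
  shows "laplacian f = (\<lambda>_. 0)"
proof
  fix y
  from assms obtain a where a: "f = (\<lambda>y. \<Sum>\<mu> | mi_size \<mu> = m. a \<mu> * mi_power y \<mu>)"
    unfolding homogeneous_polynomial_def by blast
  have "real (\<mu> $ i) * real (\<mu> $ i - 1) = 0" if "mi_size \<mu> = m" for \<mu> :: "nat ^ 'a" and i
  proof -
    have "\<mu> $ i \<le> m"
      using that unfolding mi_size_def using member_le_sum[of i UNIV "\<lambda>i. \<mu> $ i"] by simp
    then show ?thesis using assms(2) by auto
  qed
  then show "laplacian f y = 0"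
    unfolding a laplacian_sum_monomials[where \<nu>="\<lambda>\<mu>. \<mu>"]
    by (intro sum.neutral ballI) (simp only: mem_Collect_eq mult_zero_left sum.neutral_const mult_zero_right)
qed

lemma homogeneous_polynomial_laplacian:
  assumes "homogeneous_polynomial m f"
  shows "homogeneous_polynomial (m - 2) (laplacian f)"
proof -
  from assms obtain a where a: "f = (\<lambda>y. \<Sum>\<mu> | mi_size \<mu> = m. a \<mu> * mi_power y \<mu>)"
    unfolding homogeneous_polynomial_def by blast
  have *: "homogeneous_polynomial (m - 2)
      (\<lambda>y. real (\<mu> $ i) * real (\<mu> $ i - 1) * mi_power y (\<mu> - axis i 2))"
    if "mi_size \<mu> = m" for \<mu> :: "nat ^ 'a" and i
  proof (cases "2 \<le> \<mu> $ i")
    case True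
    then have "axis i 2 \<le> \<mu>" by (auto simp: less_eq_vec_def axis_def)
    then have "mi_size (\<mu> - axis i 2) = m - 2" using that by (simp add: mi_size_diff)
    then show ?thesis by (intro homogeneous_polynomial_scale homogeneous_polynomial_monomial)
  next
    case False
    then have "real (\<mu> $ i) * real (\<mu> $ i - 1) = 0" by auto
    then show ?thesis by (simp only: mult_zero_left homogeneous_polynomial_zero)
  qed
  \<comment> \<open>The factor 1 puts the inner sum into the shape of
    \<open>homogeneous_polynomial_lincomb\<close>.\<close>
  have "homogeneous_polynomial (m - 2) (\<lambda>y. \<Sum>\<mu> | mi_size \<mu> = m. a \<mu> *
      (\<Sum>i\<in>UNIV. 1 * (real (\<mu> $ i) * real (\<mu> $ i - 1) * mi_power y (\<mu> - axis i 2))))"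
    by (intro homogeneous_polynomial_lincomb *) simp
  moreover have "laplacian f = (\<lambda>y. \<Sum>\<mu> | mi_size \<mu> = m. a \<mu> *
      (\<Sum>i\<in>UNIV. 1 * (real (\<mu> $ i) * real (\<mu> $ i - 1) * mi_power y (\<mu> - axis i 2))))"
    unfolding a laplacian_sum_monomials[where \<nu>="\<lambda>\<mu>. \<mu>"] mult_1 ..
  ultimately show ?thesis by simp
qed

lemma homogeneous_polynomial_laplacian_power:
  "homogeneous_polynomial m f \<Longrightarrow> homogeneous_polynomial (m - 2 * j) ((laplacian ^^ j) f)"
proof (induction j)
  case (Suc j)
  then have "homogeneous_polynomial (m - 2 * j - 2) (laplacian ((laplacian ^^ j) f))"
    by (intro homogeneous_polynomial_laplacian) auto
  then show ?case by (simp add: diff_diff_left add.commute)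
qed simp

lemma laplacian_power_zero: "(laplacian ^^ j) (\<lambda>_. 0) = (\<lambda>_. 0)"
  by (induction j) (simp_all add: laplacian_zero)

lemma laplacian_power_lincomb:
  assumes "\<And>s. s \<in> A \<Longrightarrow> homogeneous_polynomial m (f s)"
  shows "(laplacian ^^ j) (\<lambda>y. \<Sum>s\<in>A. c s * f s y) = (\<lambda>y. \<Sum>s\<in>A. c s * (laplacian ^^ j) (f s) y)"
proof (induction j)
  case (Suc j)
  then show ?case
    by (simp add: laplacian_lincomb[OF homogeneous_polynomial_laplacian_power[OF assms]])
qed simp

section \<open>Multiplication by powers of the squared norm\<close>

lemma homogeneous_polynomial_norm_power2:
  assumes "homogeneous_polynomial m (f :: real ^ 'n::finite \<Rightarrow> real)"
  shows "homogeneous_polynomial (m + 2) (\<lambda>y. norm y ^ 2 * f y)"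
proof -
  from assms obtain a where a: "f = (\<lambda>y. \<Sum>\<mu> | mi_size \<mu> = m. a \<mu> * mi_power y \<mu>)"
    unfolding homogeneous_polynomial_def by blast
  have "homogeneous_polynomial (m + 2)
      (\<lambda>y. \<Sum>\<mu> | mi_size \<mu> = m. a \<mu> * (\<Sum>i\<in>UNIV. 1 * mi_power y (\<mu> + axis i 2)))"
    by (intro homogeneous_polynomial_lincomb homogeneous_polynomial_monomial) simp
  moreover have "norm y ^ 2 * f y =
      (\<Sum>\<mu> | mi_size \<mu> = m. a \<mu> * (\<Sum>i\<in>UNIV. 1 * mi_power y (\<mu> + axis i 2)))" for y
    by (simp add: a norm_power2_sum mi_power_add sum_distrib_left sum_distrib_right
        sum.swap[of _ UNIV] mult_ac)
  ultimately show ?thesis by simp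
qed

lemma homogeneous_polynomial_norm_power:
  "homogeneous_polynomial m f \<Longrightarrow> homogeneous_polynomial (m + 2 * b) (\<lambda>y. norm y ^ (2 * b) * f y)"
proof (induction b)
  case (Suc b)
  from homogeneous_polynomial_norm_power2[OF Suc.IH[OF Suc.prems]]
  show ?case by (simp add: power2_eq_square mult.assoc)
qed simp

text \<open>On a monomial, raising an exponent \<open>a\<close> by 2 changes
  \<open>a (a - 1)\<close> to \<open>(a + 2) (a + 1)\<close>, a gain of \<open>4 a + 2\<close>;
  summed over the coordinates this is \<open>4 m + 2 d\<close>.\<close>

lemma laplacian_norm_power2:
  assumes "homogeneous_polynomial m (f :: real ^ 'n::finite \<Rightarrow> real)"
  shows "laplacian (\<lambda>y. norm y ^ 2 * f y) =
    (\<lambda>y. norm y ^ 2 * laplacian f y + (4 * real m + 2 * real CARD('n)) * f y)"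
proof
  fix y :: "real ^ 'n"
  from assms obtain a where a: "f = (\<lambda>y. \<Sum>\<mu> | mi_size \<mu> = m. a \<mu> * mi_power y \<mu>)"
    unfolding homogeneous_polynomial_def by blast
  define L where "L \<mu> = (\<Sum>i\<in>UNIV. real (\<mu> $ i) * real (\<mu> $ i - 1) * mi_power y (\<mu> - axis i 2))"
    for \<mu> :: "nat ^ 'n"
  have *: "(\<Sum>j\<in>UNIV. L (\<mu> + axis j 2)) =
      norm y ^ 2 * L \<mu> + (4 * real m + 2 * real CARD('n)) * mi_power y \<mu>"
    if \<mu>: "mi_size \<mu> = m" for \<mu>
  proof -
    \<comment> \<open>For \<open>i \<noteq> j\<close> the factor \<open>y $ j ^ 2\<close> passes
      through the second derivative in coordinate \<open>i\<close>; only the diagonal gives an extra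
      term.\<close>
    have "real ((\<mu> + axis j 2) $ i) * real ((\<mu> + axis j 2) $ i - 1) * mi_power y (\<mu> + axis j 2 - axis i 2)
        = mi_power y (axis j 2) * (real (\<mu> $ i) * real (\<mu> $ i - 1) * mi_power y (\<mu> - axis i 2))
          + (if i = j then (4 * real (\<mu> $ i) + 2) * mi_power y \<mu> else 0)" for i j
    proof (cases "\<mu> $ i \<ge> 2")
      case True
      then have 1: "\<mu> + axis j 2 - axis i 2 = (\<mu> - axis i 2) + axis j 2"
        by (auto simp: vec_eq_iff axis_def)
      have 2: "mi_power y (\<mu> + axis j 2 - axis i 2) = mi_power y (axis j 2) * mi_power y (\<mu> - axis i 2)"
        unfolding 1 by (simp add: mi_power_add)
      have 3: "mi_power y \<mu> = mi_power y (axis i 2) * mi_power y (\<mu> - axis i 2)"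
      proof -
        have "\<mu> = axis i 2 + (\<mu> - axis i 2)" using True by (auto simp: vec_eq_iff axis_def)
        then show ?thesis by (metis mi_power_add)
      qed
      show ?thesis
      proof (cases "i = j")
        case i: True
        have "real (\<mu> $ i + 2) * real (\<mu> $ i + 2 - 1) = real (\<mu> $ i) * real (\<mu> $ i - 1) + (4 * real (\<mu> $ i) + 2)"
          using True by (simp add: of_nat_diff algebra_simps)
        then show ?thesis unfolding 2 using i 3
          by (simp add: algebra_simps axis_def)
      next
        case False
        then show ?thesis unfolding 2 by (simp add: axis_def)
      qed
    next
      \<comment> \<open>Exponents 0 and 1 are separate because \<open>\<mu> - axis i 2\<close>
        truncates; there \<open>(a + 2) (a + 1)\<close> equals \<open>4 a + 2\<close>
        outright.\<close>
      case False
      then have z: "real (\<mu> $ i) * real (\<mu> $ i - 1) = 0" by auto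
      show ?thesis
      proof (cases "i = j")
        case True
        have "real (\<mu> $ i + 2) * real (\<mu> $ i + 2 - 1) = 4 * real (\<mu> $ i) + 2"
        proof -
          have "\<mu> $ i = 0 \<or> \<mu> $ i = 1" using False by linarith
          then show ?thesis by auto
        qed
        moreover have "\<mu> + axis i 2 - axis i 2 = \<mu>" by (simp add: vec_eq_iff)
        ultimately show ?thesis using True z by (simp add: axis_def)
      next
        case False
        then have "(\<mu> + axis j 2) $ i = \<mu> $ i" by (simp add: axis_def)
        then show ?thesis using False by (simp only: z mult_zero_left mult_zero_right if_False add_0)
      qed
    qed
    then have "(\<Sum>j\<in>UNIV. L (\<mu> + axis j 2)) =
        norm y ^ 2 * L \<mu> + (\<Sum>j\<in>UNIV. (4 * real (\<mu> $ j) + 2) * mi_power y \<mu>)"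
      unfolding L_def norm_power2_sum sum_product by (simp add: sum.distrib)
    also have "(\<Sum>j\<in>UNIV. (4 * real (\<mu> $ j) + 2) * mi_power y \<mu>) =
        (4 * real m + 2 * real CARD('n)) * mi_power y \<mu>"
      unfolding sum_distrib_right[symmetric] \<mu>[symmetric] mi_size_def
      by (simp add: sum.distrib sum_distrib_left)
    finally show ?thesis .
  qed
  \<comment> \<open>The double sum is flattened to one over pairs so that
    \<open>laplacian_sum_monomials\<close> applies; different pairs may give the same
    monomial.\<close>
  have "norm y ^ 2 * f y = (\<Sum>(\<mu>, i)\<in>{\<mu>. mi_size \<mu> = m} \<times> UNIV. a \<mu> * mi_power y (\<mu> + axis i 2))" for y
    by (simp add: a norm_power2_sum mi_power_add sum.cartesian_product[symmetric]
        sum_distrib_left sum_distrib_right mult_ac sum.swap[of _ UNIV])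
  then have 1: "(\<lambda>y. norm y ^ 2 * f y) =
      (\<lambda>y. \<Sum>s\<in>{\<mu>. mi_size \<mu> = m} \<times> UNIV. a (fst s) * mi_power y (fst s + axis (snd s) 2))"
    by (simp add: case_prod_beta)
  have "laplacian (\<lambda>y. norm y ^ 2 * f y) y =
      (\<Sum>s\<in>{\<mu>. mi_size \<mu> = m} \<times> UNIV. a (fst s) * L (fst s + axis (snd s) 2))"
    unfolding 1 laplacian_sum_monomials L_def ..
  also have "\<dots> = (\<Sum>\<mu> | mi_size \<mu> = m. a \<mu> * (\<Sum>j\<in>UNIV. L (\<mu> + axis j 2)))"
    by (simp add: sum.cartesian_product' sum_distrib_left)
  also have "\<dots> = (\<Sum>\<mu> | mi_size \<mu> = m.
      a \<mu> * (norm y ^ 2 * L \<mu> + (4 * real m + 2 * real CARD('n)) * mi_power y \<mu>))"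
    by (intro sum.cong) (auto simp: *)
  also have "\<dots> = norm y ^ 2 * laplacian f y + (4 * real m + 2 * real CARD('n)) * f y"
  proof -
    have "laplacian f y = (\<Sum>\<mu> | mi_size \<mu> = m. a \<mu> * L \<mu>)"
      unfolding a laplacian_sum_monomials L_def ..
    then show ?thesis
      by (simp add: a distrib_left sum.distrib sum_distrib_left mult.left_commute)
  qed
  finally show "laplacian (\<lambda>y. norm y ^ 2 * f y) y =
      norm y ^ 2 * laplacian f y + (4 * real m + 2 * real CARD('n)) * f y" .
qed

text \<open>The constants \<open>4 (m + 2 j) + 2 d\<close> for \<open>j < b\<close> add up to
  \<open>2 b (2 b + 2 m + d - 2)\<close>. For \<open>b = 0\<close> this factor is 0, so the
  truncated exponent does no harm.\<close>

lemma laplacian_norm_power: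
  assumes "homogeneous_polynomial m (f :: real ^ 'n::finite \<Rightarrow> real)"
  shows "laplacian (\<lambda>y. norm y ^ (2 * b) * f y) =
    (\<lambda>y. norm y ^ (2 * b) * laplacian f y +
      2 * real b * (2 * real b + 2 * real m + real CARD('n) - 2) * (norm y ^ (2 * (b - 1)) * f y))"
proof (induction b)
  case (Suc b)
  have 1: "(\<lambda>y. norm y ^ (2 * Suc b) * f y) = (\<lambda>y. norm y ^ 2 * (norm y ^ (2 * b) * f y))"
    by (simp add: power2_eq_square mult.assoc)
  show ?case
    unfolding 1 laplacian_norm_power2[OF homogeneous_polynomial_norm_power[OF assms]] Suc.IH
    by (cases b) (auto simp: algebra_simps power2_eq_square)
qed simp

text \<open>For harmonic \<open>f\<close> only the second term of
  \<open>laplacian_norm_power\<close> survives, so each application lowers the power and contributes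
  one factor. If \<open>k > l\<close>, the factor at \<open>i = l\<close> is 0.\<close>

lemma laplacian_power_norm_power:
  assumes "homogeneous_polynomial m (f :: real ^ 'n::finite \<Rightarrow> real)" "laplacian f = (\<lambda>_. 0)"
  shows "(laplacian ^^ k) (\<lambda>y. norm y ^ (2 * l) * f y) =
    (\<lambda>y. (\<Prod>i<k. 2 * real (l - i) * (2 * real (l - i) + 2 * real m + real CARD('n) - 2)) *
      (norm y ^ (2 * (l - k)) * f y))"
proof (induction k)
  case (Suc k)
  show ?case
    unfolding funpow.simps comp_apply Suc.IH
      laplacian_scale[OF homogeneous_polynomial_norm_power[OF assms(1)]]
      laplacian_norm_power[OF assms(1)] assms(2)
    by (simp add: mult_ac)
qed simp

subsection \<open>Harmonic projection and decomposition\<close>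

lemma q_prod_pos:
  assumes "2 * k \<le> n" "d > 0"
  shows "q_prod d k n m > 0"
  unfolding q_prod_def
proof (intro prod_pos ballI)
  \<comment> \<open>Since \<open>1 \<le> j\<close>, the range forces \<open>2 k + 2 \<le> n\<close>;
    with \<open>2 j \<le> n - 2 k\<close> this gives
    \<open>4 k + 2 j + 2 \<le> n + 2 k + 2 \<le> 2 n\<close>, which suffices even for
    \<open>d = 1\<close>.\<close>
  fix j assume "j \<in> {m + 1..n div 2 - k}"
  then have "4 * k + 2 * j + 2 < 2 * n + d" using assms by auto
  then have "real (4 * k + 2 * j + 2) < real (2 * n + d)" by (subst of_nat_less_iff)
  then show "0 < 2 * real n + real d - 2 - 4 * real k - 2 * real j" by simp
qed

lemma q_prod_step:
  assumes "Suc b \<le> n div 2 - k"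
  shows "q_prod d k n b = (2 * real n + real d - 2 - 4 * real k - 2 * real (Suc b)) * q_prod d k n (Suc b)"
  unfolding q_prod_def using assms by (subst prod.atLeast_Suc_atMost) auto

text \<open>After \<open>k\<close> Laplacians the projection acts in degree \<open>n - 2 k\<close>;
  this turns its constants into those of the formula.\<close>

lemma q_prod_shift:
  assumes "2 * k \<le> n"
  shows "q_prod d 0 (n - 2 * k) m = q_prod d k n m"
proof -
  have "(n - 2 * k) div 2 = n div 2 - k" by simp
  then show ?thesis using assms by (simp add: q_prod_def of_nat_diff algebra_simps)
qed

text \<open>
  Up to the constant \<^const>\<open>q_prod\<close>, this is the projection of a homogeneous polynomial of degree
  \<open>m\<close> onto the harmonic ones along the multiples of \<open>|y|\<^sup>2\<close>.
\<close>

definition harmonic_projection :: "nat \<Rightarrow> (real ^ 'n::finite \<Rightarrow> real) \<Rightarrow> real ^ 'n \<Rightarrow> real" where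
  "harmonic_projection m f y = (\<Sum>b\<le>m div 2.
     (- 1 / 2) ^ b / fact b * q_prod CARD('n) 0 m b * (norm y ^ (2 * b) * (laplacian ^^ b) f y))"

lemma homogeneous_polynomial_projection_term:
  assumes "homogeneous_polynomial m f" "b \<le> m div 2"
  shows "homogeneous_polynomial m (\<lambda>y. norm y ^ (2 * b) * (laplacian ^^ b) f y)"
  using homogeneous_polynomial_norm_power[OF homogeneous_polynomial_laplacian_power[OF assms(1)], of b b]
    assms(2) by simp

lemma homogeneous_polynomial_harmonic_projection:
  assumes "homogeneous_polynomial m f"
  shows "homogeneous_polynomial m (harmonic_projection m f)"
  unfolding harmonic_projection_def[abs_def]
  by (intro homogeneous_polynomial_lincomb homogeneous_polynomial_projection_term assms) simp

lemma harmonic_projection_lincomb: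
  assumes "\<And>s. s \<in> A \<Longrightarrow> homogeneous_polynomial m' (f s)"
  shows "harmonic_projection m (\<lambda>y. \<Sum>s\<in>A. c s * f s y) y = (\<Sum>s\<in>A. c s * harmonic_projection m (f s) y)"
proof -
  have "(laplacian ^^ b) (\<lambda>y. \<Sum>s\<in>A. c s * f s y) = (\<lambda>y. \<Sum>s\<in>A. c s * (laplacian ^^ b) (f s) y)" for b
    by (rule laplacian_power_lincomb) (rule assms)
  then show ?thesis
    by (simp add: harmonic_projection_def sum_distrib_left sum.swap[of _ A] mult_ac)
qed

lemma harmonic_projection_zero: "harmonic_projection m (\<lambda>_. 0) y = 0"
  by (simp add: harmonic_projection_def laplacian_power_zero)

lemma harmonic_projection_scale:
  "homogeneous_polynomial m' f \<Longrightarrow>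
    harmonic_projection m (\<lambda>y. c * f y) y = c * harmonic_projection m f y"
  using harmonic_projection_lincomb[of "{()}" m' "\<lambda>_. f" m "\<lambda>_. c"] by simp

text \<open>Only the term \<open>b = 0\<close> survives, which leaves the normalising factor that
  reappears in \<open>omega\<close>.\<close>

lemma harmonic_projection_harmonic:
  assumes "laplacian f = (\<lambda>_. 0)"
  shows "harmonic_projection m (f :: real ^ 'n::finite \<Rightarrow> real) y = q_prod CARD('n) 0 m 0 * f y"
proof -
  have "(laplacian ^^ b) f = (\<lambda>_. 0)" if "b \<noteq> 0" for b
    using that assms by (cases b) (simp_all add: funpow_swap1 laplacian_power_zero)
  then have "harmonic_projection m f y = (\<Sum>b\<in>{0}.
      (- 1 / 2) ^ b / fact b * q_prod CARD('n) 0 m b * (norm y ^ (2 * b) * (laplacian ^^ b) f y))"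
    unfolding harmonic_projection_def by (intro sum.mono_neutral_right) auto
  then show ?thesis by simp
qed

text \<open>By \<open>laplacian_norm_power\<close> each summand yields a multiple of
  \<open>|y|^(2 b) \<Delta>^(b + 1) f\<close> and one of \<open>|y|^(2 b - 2) \<Delta>^b f\<close>;
  the coefficients make the second part at \<open>b + 1\<close> cancel the first part at
  \<open>b\<close>.\<close>

lemma laplacian_harmonic_projection:
  assumes "homogeneous_polynomial m (f :: real ^ 'n::finite \<Rightarrow> real)"
  shows "laplacian (harmonic_projection m f) = (\<lambda>_. 0)"
proof
  fix y
  define c where "c b = (- 1 / 2) ^ b / fact b * q_prod CARD('n) 0 m b" for b
  define t where "t b = c b * (norm y ^ (2 * b) * laplacian ((laplacian ^^ b) f) y +
      2 * real b * (2 * real b + 2 * real (m - 2 * b) + real CARD('n) - 2) *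
        (norm y ^ (2 * (b - 1)) * (laplacian ^^ b) f y))" for b
  have "laplacian (harmonic_projection m f) y = (\<Sum>b\<le>m div 2. t b)"
    unfolding harmonic_projection_def[abs_def] t_def c_def
    by (subst laplacian_lincomb[where m=m])
      (auto intro!: homogeneous_polynomial_projection_term assms
        simp: laplacian_norm_power[OF homogeneous_polynomial_laplacian_power[OF assms]])
  \<comment> \<open>Telescoping: a partial sum retains only the uncancelled part of its last
    summand.\<close>
  also have "(\<Sum>b\<le>N. t b) = c N * (norm y ^ (2 * N) * laplacian ((laplacian ^^ N) f) y)"
    if "N \<le> m div 2" for N
    using that
  proof (induction N)
    case (Suc N)
    have "2 * Suc N \<le> m" using Suc.prems by presburger
    then have m: "real (m - 2 * Suc N) = real m - 2 * real (Suc N)" by (simp add: of_nat_diff)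
    define x where "x = real (Suc N)"
    have x: "x > 0" "fact (Suc N) = x * fact N" by (simp_all add: x_def)
    have q: "q_prod CARD('n) 0 m N = (2 * real m + real CARD('n) - 2 - 2 * x) * q_prod CARD('n) 0 m (Suc N)"
      using q_prod_step[of N m 0 "CARD('n)"] Suc.prems by (simp add: x_def)
    \<comment> \<open>Here \<open>2 x + 2 (m - 2 x) + d - 2\<close> is exactly the factor
      \<open>2 m + d - 2 - 2 x\<close> split off from \<open>q_prod\<close>, and \<open>x\<close>
      comes from the factorial.\<close>
    have "c N = - (2 * x * (2 * x + 2 * (real m - 2 * x) + real CARD('n) - 2)) * c (Suc N)"
      unfolding c_def x(2) q power_Suc using x(1) by (simp add: divide_simps)
    then have "c N = - (2 * real (Suc N) *
        (2 * real (Suc N) + 2 * real (m - 2 * Suc N) + real CARD('n) - 2)) * c (Suc N)"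
      unfolding m x_def .
    with Suc show ?case
      unfolding sum.atMost_Suc t_def[of "Suc N"] by (simp del: of_nat_Suc add: algebra_simps)
  qed (simp add: t_def)
  then have "(\<Sum>b\<le>m div 2. t b) =
      c (m div 2) * (norm y ^ (2 * (m div 2)) * laplacian ((laplacian ^^ (m div 2)) f) y)"
    by simp
  \<comment> \<open>The remaining degree \<open>m - 2 * (m div 2)\<close> is below 2.\<close>
  also have "laplacian ((laplacian ^^ (m div 2)) f) = (\<lambda>_. 0)"
    by (rule homogeneous_polynomial_laplacian_low[OF homogeneous_polynomial_laplacian_power[OF assms]])
      linarith
  finally show "laplacian (harmonic_projection m f) y = 0" by simp
qed

text \<open>Every summand with \<open>b \<ge> 1\<close> contains the factor \<open>|y|^2\<close>,
  and \<open>g\<close> collects the quotients. For \<open>m < 2\<close> there are none and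
  \<open>g\<close> is 0.\<close>

lemma harmonic_projection_split:
  assumes "homogeneous_polynomial m (f :: real ^ 'n::finite \<Rightarrow> real)"
  obtains g where "homogeneous_polynomial (m - 2) g"
    "\<And>y. harmonic_projection m f y = q_prod CARD('n) 0 m 0 * f y + norm y ^ 2 * g y"
proof
  define c where "c b = (- 1 / 2) ^ b / fact b * q_prod CARD('n) 0 m b" for b
  let ?g = "\<lambda>y. \<Sum>b\<in>{1..m div 2}. c b * (norm y ^ (2 * (b - 1)) * (laplacian ^^ b) f y)"
  show "homogeneous_polynomial (m - 2) ?g"
  proof (intro homogeneous_polynomial_lincomb)
    fix b assume "b \<in> {1..m div 2}"
    then have "m - 2 * b + 2 * (b - 1) = m - 2" by auto
    then show "homogeneous_polynomial (m - 2) (\<lambda>y. norm y ^ (2 * (b - 1)) * (laplacian ^^ b) f y)"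
      using homogeneous_polynomial_norm_power[where b="b - 1",
          OF homogeneous_polynomial_laplacian_power[where j=b, OF assms]]
      by simp
  qed
  fix y
  have "{..m div 2} = insert 0 {1..m div 2}" by auto
  then have "harmonic_projection m f y =
      c 0 * f y + (\<Sum>b\<in>{1..m div 2}. c b * (norm y ^ (2 * b) * (laplacian ^^ b) f y))"
    unfolding harmonic_projection_def c_def by simp
  also have "(\<Sum>b\<in>{1..m div 2}. c b * (norm y ^ (2 * b) * (laplacian ^^ b) f y)) = norm y ^ 2 * ?g y"
    unfolding sum_distrib_left
  proof (intro sum.cong refl)
    fix b assume "b \<in> {1..m div 2}"
    then have "2 * b = 2 + 2 * (b - 1)" by auto
    then have "norm y ^ (2 * b) = norm y ^ 2 * norm y ^ (2 * (b - 1))"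
      by (simp only: power_add[symmetric])
    then show "c b * (norm y ^ (2 * b) * (laplacian ^^ b) f y) =
        norm y ^ 2 * (c b * (norm y ^ (2 * (b - 1)) * (laplacian ^^ b) f y))"
      by (simp only: mult_ac)
  qed
  finally show "harmonic_projection m f y = q_prod CARD('n) 0 m 0 * f y + norm y ^ 2 * ?g y"
    by (simp add: c_def)
qed

text \<open>
  Applying \<open>\<Delta>\<close> to the equation gives the same equation for \<open>\<Delta>f\<close> with a larger constant,
  so induction on the degree applies.
\<close>

lemma norm_power2_laplacian_eigen_zero:
  assumes "homogeneous_polynomial s (f :: real ^ 'n::finite \<Rightarrow> real)" "c > 0"
    and "\<And>y. norm y ^ 2 * laplacian f y = - c * f y"
  shows "f = (\<lambda>_. 0)"
  using assms
proof (induction s arbitrary: f c rule: less_induct)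
  case (less s)
  have "laplacian f = (\<lambda>_. 0)"
  proof (cases "s < 2")
    case True
    with less.prems show ?thesis by (intro homogeneous_polynomial_laplacian_low)
  next
    case False
    have T: "homogeneous_polynomial (s - 2) (laplacian f)"
      by (rule homogeneous_polynomial_laplacian) fact
    have "laplacian (\<lambda>y. norm y ^ 2 * laplacian f y) y = - c * laplacian f y" for y
      using less.prems(3) laplacian_scale[OF less.prems(1), of "- c"] by simp
    then have "norm y ^ 2 * laplacian (laplacian f) y =
        - (c + 4 * real (s - 2) + 2 * real CARD('n)) * laplacian f y" for y
      unfolding laplacian_norm_power2[OF T] by (simp add: algebra_simps)
    moreover have "c + 4 * real (s - 2) + 2 * real CARD('n) > 0" using less.prems(2) by simp
    moreover have "s - 2 < s" using False by simp
    ultimately show ?thesis using less.IH[of "s - 2" "laplacian f"] T by blast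
  qed
  with less.prems show ?case by auto
qed

text \<open>The image is harmonic and, by the split, again of the form \<open>|y|^2 s\<close>. Then
  \<open>|y|^2 \<Delta> s = - (4 m + 2 d) s\<close>, which forces \<open>s = 0\<close>.\<close>

lemma harmonic_projection_norm_power2:
  assumes "homogeneous_polynomial m (f :: real ^ 'n::finite \<Rightarrow> real)"
  shows "harmonic_projection (m + 2) (\<lambda>y. norm y ^ 2 * f y) = (\<lambda>_. 0)"
proof -
  note hom = homogeneous_polynomial_norm_power2[OF assms]
  obtain g where g': "homogeneous_polynomial (m + 2 - 2) g"
    and split: "\<And>y. harmonic_projection (m + 2) (\<lambda>y. norm y ^ 2 * f y) y =
      q_prod CARD('n) 0 (m + 2) 0 * (norm y ^ 2 * f y) + norm y ^ 2 * g y"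
    using harmonic_projection_split[OF hom] by blast
  from g' have g: "homogeneous_polynomial m g" by simp
  let ?s = "\<lambda>y. q_prod CARD('n) 0 (m + 2) 0 * f y + g y"
  have s: "homogeneous_polynomial m ?s"
    by (intro homogeneous_polynomial_add homogeneous_polynomial_scale assms g)
  have proj: "harmonic_projection (m + 2) (\<lambda>y. norm y ^ 2 * f y) = (\<lambda>y. norm y ^ 2 * ?s y)"
    using split by (simp add: fun_eq_iff algebra_simps)
  have "norm y ^ 2 * laplacian ?s y = - (4 * real m + 2 * real CARD('n)) * ?s y" for y
    using fun_cong[OF laplacian_harmonic_projection[OF hom], of y] 
    unfolding proj laplacian_norm_power2[OF s] by (simp add: algebra_simps)
  then have "?s = (\<lambda>_. 0)"
    by (rule norm_power2_laplacian_eigen_zero[OF s, rotated]) (simp add: add_nonneg_pos)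
  then show ?thesis unfolding proj by (metis mult_zero_right)
qed

section \<open>Existence of the decomposition and recovery of its components\<close>

lemma is_harmonic_iff: "is_harmonic f \<longleftrightarrow> laplacian f = (\<lambda>_. 0)"
  by (auto simp: is_harmonic_def)

lemma homogeneous_polynomial_decomposition:
  assumes "homogeneous_polynomial m (f :: real ^ 'n::finite \<Rightarrow> real)"
  obtains h where "\<And>k. 2 * k \<le> m \<Longrightarrow> homogeneous_polynomial (m - 2 * k) (h k)"
    "\<And>k. 2 * k \<le> m \<Longrightarrow> laplacian (h k) = (\<lambda>_. 0)"
    "\<And>y. f y = (\<Sum>k = 0..m div 2. norm y ^ (2 * k) * h k y)"
proof -
  have "\<exists>h. (\<forall>k. 2 * k \<le> m \<longrightarrow> homogeneous_polynomial (m - 2 * k) (h k) \<and> laplacian (h k) = (\<lambda>_. 0)) \<and>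
      (\<forall>y. f y = (\<Sum>k = 0..m div 2. norm y ^ (2 * k) * h k y))"
    using assms
  proof (induction m arbitrary: f rule: less_induct)
    case (less m)
    show ?case
    proof (cases "m < 2")
      case True
      have "homogeneous_polynomial (m - 2 * k) f \<and> laplacian f = (\<lambda>_. 0)" if "2 * k \<le> m" for k
      proof -
        have "k = 0" using that True by simp
        then show ?thesis using less.prems homogeneous_polynomial_laplacian_low[OF less.prems True] by simp
      qed
      moreover have "f y = (\<Sum>k = 0..m div 2. norm y ^ (2 * k) * f y)" for y
        using True by simp
      ultimately show ?thesis by (intro exI[of _ "\<lambda>_. f"]) blast
    next
      case False
      define Q where "Q = q_prod CARD('n) 0 m 0"
      have Q: "Q > 0" unfolding Q_def by (rule q_prod_pos) simp_all
      obtain g where g: "homogeneous_polynomial (m - 2) g"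
        "\<And>y. harmonic_projection m f y = Q * f y + norm y ^ 2 * g y"
        using harmonic_projection_split[OF less.prems] unfolding Q_def by metis
      have "m - 2 < m" using False by simp
      from less.IH[OF this homogeneous_polynomial_scale[OF g(1), of "- (1 / Q)"]] obtain h where
        h: "\<And>k. 2 * k \<le> m - 2 \<Longrightarrow> homogeneous_polynomial (m - 2 - 2 * k) (h k) \<and> laplacian (h k) = (\<lambda>_. 0)"
          "\<And>y. - (1 / Q) * g y = (\<Sum>k = 0..(m - 2) div 2. norm y ^ (2 * k) * h k y)"
        by blast
      \<comment> \<open>Solving the split for \<open>f\<close> gives
        \<open>f = (1 / Q) P f + |y|^2 (- g / Q)\<close>, where \<open>P\<close> is the projection;
        the components of \<open>- g / Q\<close> move up by one index.\<close>
      define h' where "h' k = (if k = 0 then (\<lambda>y. (1 / Q) * harmonic_projection m f y) else h (k - 1))" for k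
      have "homogeneous_polynomial (m - 2 * k) (h' k) \<and> laplacian (h' k) = (\<lambda>_. 0)" if "2 * k \<le> m" for k
      proof (cases k)
        case 0
        note P = homogeneous_polynomial_harmonic_projection[OF less.prems]
        show ?thesis using 0 homogeneous_polynomial_scale[OF P, of "1 / Q"]
            laplacian_scale[OF P, of "1 / Q"] laplacian_harmonic_projection[OF less.prems]
          by (simp add: h'_def)
      next
        case (Suc l)
        with h(1)[of l] that show ?thesis by (simp add: h'_def)
      qed
      moreover have "f y = (\<Sum>k = 0..m div 2. norm y ^ (2 * k) * h' k y)" for y
      proof -
        have "m div 2 = Suc ((m - 2) div 2)" using False by auto
        then have "(\<Sum>k = 0..m div 2. norm y ^ (2 * k) * h' k y) =
            h' 0 y + (\<Sum>k = 0..(m - 2) div 2. norm y ^ (2 * Suc k) * h' (Suc k) y)"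
          by (simp only: sum.atLeast0_atMost_Suc_shift comp_def) simp
        also have "\<dots> = h' 0 y + norm y ^ 2 * (- (1 / Q) * g y)"
          unfolding h(2) by (simp add: h'_def sum_distrib_left power2_eq_square mult.assoc)
        also have "\<dots> = f y" using Q by (simp add: h'_def g(2) field_simps)
        finally show ?thesis ..
      qed
      ultimately show ?thesis by blast
    qed
  qed
  then show thesis using that by blast
qed

text \<open>Evaluates the constant of \<open>laplacian_power_norm_power\<close> at
  \<open>l = k\<close> in degree \<open>n - 2 k\<close>: the factors \<open>k - i\<close> give
  \<open>k!\<close>, and \<open>j = i + 1\<close> turns the rest into the product in
  \<open>omega\<close>.\<close>

lemma prod_norm_power_factors:
  assumes "2 * k \<le> n"
  shows "(\<Prod>i<k. 2 * real (k - i) * (2 * real (k - i) + 2 * real (n - 2 * k) + real d - 2)) =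
    2 ^ k * fact k * (\<Prod>j = 1..k. 2 * real n + real d - 2 * real k - 2 * real j)"
proof -
  have "(\<Prod>i<k. 2 * real (k - i) * (2 * real (k - i) + 2 * real (n - 2 * k) + real d - 2)) =
      2 ^ k * (\<Prod>i<k. real (k - i)) * (\<Prod>i<k. 2 * real (k - i) + 2 * real (n - 2 * k) + real d - 2)"
    by (simp only: prod.distrib prod_constant card_lessThan)
  also have "(\<Prod>i<k. real (k - i)) = fact k"
    unfolding fact_prod_rev by (simp add: atLeast0LessThan)
  also have "(\<Prod>i<k. 2 * real (k - i) + 2 * real (n - 2 * k) + real d - 2) =
      (\<Prod>j = 1..k. 2 * real n + real d - 2 * real k - 2 * real j)"
    using assms
    by (intro prod.reindex_bij_witness[of _ "\<lambda>j. j - 1" Suc]) (auto simp: of_nat_diff algebra_simps)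
  finally show ?thesis .
qed

text \<open>Only the component \<open>l = k\<close> survives: those with \<open>l < k\<close> are
  annihilated by the iterated Laplacian, and those with \<open>l > k\<close> remain multiples of
  \<open>|y|^2\<close>, which the projection annihilates.\<close>

lemma harmonic_projection_laplacian_power:
  assumes hom: "\<And>k. 2 * k \<le> n \<Longrightarrow> homogeneous_polynomial (n - 2 * k) (h k)"
    and harm: "\<And>k. 2 * k \<le> n \<Longrightarrow> laplacian (h k) = (\<lambda>_. 0)"
    and f: "\<And>y. f y = (\<Sum>k = 0..n div 2. norm (y :: real ^ 'n::finite) ^ (2 * k) * h k y)"
    and k: "2 * k \<le> n"
  shows "harmonic_projection (n - 2 * k) ((laplacian ^^ k) f) y =
    2 ^ k * fact k * (\<Prod>j = 1..k. 2 * real n + real CARD('n) - 2 * real k - 2 * real j) *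
      q_prod CARD('n) k n 0 * h k y" (is "_ = ?R")
proof -
  define u where "u l = (\<lambda>y. norm y ^ (2 * l) * h l y)" for l
  define \<Lambda> where "\<Lambda> l = (\<Prod>i<k. 2 * real (l - i) *
    (2 * real (l - i) + 2 * real (n - 2 * l) + real CARD('n) - 2))" for l
  have u: "homogeneous_polynomial n (u l)" if "l \<in> {0..n div 2}" for l
    using homogeneous_polynomial_norm_power[OF hom[of l], of l] that by (simp add: u_def)
  have "f = (\<lambda>y. \<Sum>l\<in>{0..n div 2}. 1 * u l y)" by (simp add: fun_eq_iff f u_def)
  then have "(laplacian ^^ k) f = (\<lambda>y. \<Sum>l\<in>{0..n div 2}. 1 * (laplacian ^^ k) (u l) y)"
    using laplacian_power_lincomb[of "{0..n div 2}" n u k "\<lambda>_. 1", OF u] by simp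
  then have "harmonic_projection (n - 2 * k) ((laplacian ^^ k) f) y =
      (\<Sum>l\<in>{0..n div 2}. harmonic_projection (n - 2 * k) ((laplacian ^^ k) (u l)) y)"
    using harmonic_projection_lincomb[of "{0..n div 2}" "n - 2 * k" "\<lambda>l. (laplacian ^^ k) (u l)" _ "\<lambda>_. 1",
        OF homogeneous_polynomial_laplacian_power[OF u]] by simp
  also have "\<dots> = (\<Sum>l\<in>{0..n div 2}. if l = k then ?R else 0)"
  proof (intro sum.cong refl)
    fix l assume l: "l \<in> {0..n div 2}"
    then have l': "2 * l \<le> n" by auto
    have lap: "(laplacian ^^ k) (u l) = (\<lambda>y. \<Lambda> l * (norm y ^ (2 * (l - k)) * h l y))"
      unfolding u_def \<Lambda>_def by (rule laplacian_power_norm_power[OF hom[OF l'] harm[OF l']])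
    consider "l < k" | "l = k" | "l > k" by linarith
    then show "harmonic_projection (n - 2 * k) ((laplacian ^^ k) (u l)) y = (if l = k then ?R else 0)"
    proof cases
      case 1
      then have "\<Lambda> l = 0" unfolding \<Lambda>_def by (intro prod_zero) (auto intro!: bexI[of _ l])
      with 1 show ?thesis by (simp add: lap harmonic_projection_zero)
    next
      case 2
      have "harmonic_projection (n - 2 * k) (\<lambda>y. \<Lambda> k * h k y) y = \<Lambda> k * (q_prod CARD('n) 0 (n - 2 * k) 0 * h k y)"
        using harmonic_projection_scale[OF hom[OF k]] harmonic_projection_harmonic[OF harm[OF k]] by simp
      moreover have "\<Lambda> k = 2 ^ k * fact k * (\<Prod>j = 1..k. 2 * real n + real CARD('n) - 2 * real k - 2 * real j)"
        unfolding \<Lambda>_def by (rule prod_norm_power_factors[OF k])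
      ultimately show ?thesis unfolding lap by (simp add: 2 q_prod_shift[OF k])
    next
      case 3
      \<comment> \<open>One factor \<open>|y|^2\<close> is split off, so that
        \<open>harmonic_projection_norm_power2\<close> applies.\<close>
      define v where "v = (\<lambda>y. norm y ^ (2 * (l - k - 1)) * h l y)"
      have v: "homogeneous_polynomial (n - 2 * k - 2) v"
        using homogeneous_polynomial_norm_power[OF hom[OF l'], of "l - k - 1"] 3 l'
        by (simp add: v_def algebra_simps)
      have n: "n - 2 * k - 2 + 2 = n - 2 * k" using 3 l' by linarith
      have "2 * (l - k) = 2 + 2 * (l - k - 1)" using 3 by linarith
      then have "(\<lambda>y. norm y ^ (2 * (l - k)) * h l y) = (\<lambda>y. norm y ^ 2 * v y)"
        unfolding v_def by (simp only: power_add mult.assoc)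
      then have "(laplacian ^^ k) (u l) = (\<lambda>y. \<Lambda> l * (norm y ^ 2 * v y))"
        unfolding lap by (simp add: fun_eq_iff)
      then show ?thesis
        using 3 harmonic_projection_scale[OF homogeneous_polynomial_norm_power2[OF v]]
          harmonic_projection_norm_power2[OF v, unfolded n]
        by simp
    qed
  qed
  also have "\<dots> = ?R" using k by simp
  finally show ?thesis .
qed

subsection \<open>Multinomial expansions\<close>

text \<open>
  The inductive step of the multinomial theorem for commuting operators, with \<open>F \<delta>\<close> in the place
  of the product of powers: it yields both \<open>|y|\<^bsup>2b\<^esup>\<close> and \<open>\<Delta>\<^sup>j y\<^sup>\<alpha>\<close>.
\<close>

lemma multinomial_step:
  fixes F :: "nat ^ 'n::finite \<Rightarrow> real"
  shows "(\<Sum>\<delta> | mi_size \<delta> = Suc j. fact (Suc j) / mi_fact \<delta> * F \<delta>) =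
    (\<Sum>\<delta> | mi_size \<delta> = j. fact j / mi_fact \<delta> * (\<Sum>i\<in>UNIV. F (\<delta> + axis i 1)))"
proof -
  have fact: "mi_fact (\<delta> + axis i 1) = real (\<delta> $ i + 1) * mi_fact \<delta>" for \<delta> :: "nat ^ 'n" and i
    unfolding mi_fact_def
    by (subst (1 2) prod.remove[of _ i]) (auto simp: axis_def algebra_simps intro!: prod.cong)
  \<comment> \<open>Lowering \<delta> in coordinate \<open>i\<close> divides its factorial by
    \<open>\<delta> $ i\<close>; indices with \<open>\<delta> $ i = 0\<close> enter with weight
    0.\<close>
  have shift: "(\<Sum>\<delta> | mi_size \<delta> = j. fact j / mi_fact \<delta> * F (\<delta> + axis i 1)) =
      (\<Sum>\<delta> | mi_size \<delta> = Suc j. real (\<delta> $ i) * (fact j / mi_fact \<delta> * F \<delta>))" for i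
  proof -
    have le: "axis i 1 \<le> \<delta> \<and> \<delta> - axis i 1 + axis i 1 = \<delta>" if "\<delta> $ i > 0" for \<delta> :: "nat ^ 'n"
      using that by (auto simp: less_eq_vec_def vec_eq_iff axis_def)
    have "(\<Sum>\<delta> | mi_size \<delta> = Suc j. real (\<delta> $ i) * (fact j / mi_fact \<delta> * F \<delta>)) =
        (\<Sum>\<delta> | mi_size \<delta> = Suc j \<and> \<delta> $ i > 0. real (\<delta> $ i) * (fact j / mi_fact \<delta> * F \<delta>))"
      by (rule sum.mono_neutral_right) auto
    also have "\<dots> = (\<Sum>\<delta> | mi_size \<delta> = j. fact j / mi_fact \<delta> * F (\<delta> + axis i 1))"
    proof (rule sum.reindex_bij_witness[of _ "\<lambda>\<delta>. \<delta> + axis i 1" "\<lambda>\<delta>. \<delta> - axis i 1"])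
      fix \<delta> assume "\<delta> \<in> {\<delta>. mi_size \<delta> = Suc j \<and> \<delta> $ i > 0}"
      then have \<delta>: "mi_size \<delta> = Suc j" "\<delta> $ i > 0" by auto
      show "\<delta> - axis i 1 + axis i 1 = \<delta>" using le[OF \<delta>(2)] by blast
      show "\<delta> - axis i 1 \<in> {\<delta>. mi_size \<delta> = j}" using \<delta>(1) le[OF \<delta>(2)] by (simp add: mi_size_diff)
      have "mi_fact \<delta> = real (\<delta> $ i) * mi_fact (\<delta> - axis i 1)"
        using fact[of "\<delta> - axis i 1" i] le[OF \<delta>(2)] \<delta>(2) by (simp add: axis_def)
      then show "fact j / mi_fact (\<delta> - axis i 1) * F (\<delta> - axis i 1 + axis i 1) =
          real (\<delta> $ i) * (fact j / mi_fact \<delta> * F \<delta>)"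
        using \<delta>(2) le[OF \<delta>(2)] by simp
    qed (auto simp: vec_eq_iff)
    finally show ?thesis ..
  qed
  have "(\<Sum>\<delta> | mi_size \<delta> = j. fact j / mi_fact \<delta> * (\<Sum>i\<in>UNIV. F (\<delta> + axis i 1))) =
      (\<Sum>i\<in>UNIV. \<Sum>\<delta> | mi_size \<delta> = Suc j. real (\<delta> $ i) * (fact j / mi_fact \<delta> * F \<delta>))"
    unfolding sum_distrib_left shift[symmetric] by (rule sum.swap)
  \<comment> \<open>The weights \<open>\<delta> $ i\<close> add up to \<open>Suc j\<close>, which
    turns \<open>fact j\<close> into \<open>fact (Suc j)\<close>.\<close>
  also have "\<dots> = (\<Sum>\<delta> | mi_size \<delta> = Suc j. real (mi_size \<delta>) * (fact j / mi_fact \<delta> * F \<delta>))"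
    unfolding mi_size_def of_nat_sum sum_distrib_right by (rule sum.swap)
  also have "\<dots> = (\<Sum>\<delta> | mi_size \<delta> = Suc j. fact (Suc j) / mi_fact \<delta> * F \<delta>)"
    by (intro sum.cong) (auto simp: field_simps)
  finally show ?thesis ..
qed

lemma mi_size_0_iff: "mi_size \<mu> = 0 \<longleftrightarrow> \<mu> = 0"
  by (auto simp: mi_size_def vec_eq_iff)

lemma mi_fact_0 [simp]: "mi_fact 0 = 1"
  by (simp add: mi_fact_def)

lemma mi_power_0 [simp]: "mi_power y 0 = 1"
  by (simp add: mi_power_def)

lemma double_add_axis: "2 * (\<delta> + axis i 1) = 2 * \<delta> + (axis i 2 :: nat ^ 'n::finite)"
  by (auto simp: vec_eq_iff axis_def)

lemma norm_power_multinomial: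
  fixes y :: "real ^ 'n::finite"
  shows "norm y ^ (2 * b) = (\<Sum>\<beta> | mi_size \<beta> = b. fact b / mi_fact \<beta> * mi_power y (2 * \<beta>))"
proof (induction b)
  case 0
  then show ?case by (simp add: mi_size_0_iff)
next
  case (Suc b)
  have "norm y ^ (2 * Suc b) = norm y ^ (2 * b) * norm y ^ 2"
    by (simp add: power2_eq_square)
  also have "\<dots> = (\<Sum>\<beta> | mi_size \<beta> = b. fact b / mi_fact \<beta> *
      (\<Sum>i\<in>UNIV. mi_power y (2 * (\<beta> + axis i 1))))"
    unfolding Suc.IH norm_power2_sum sum_distrib_right double_add_axis mi_power_add
    by (simp add: sum_distrib_left mult.assoc)
  finally show ?case unfolding multinomial_step .
qed

section \<open>Falling factorials and iterated Laplacians of monomials\<close>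

lemma falling_Suc_nat: "falling (real a) (Suc k) = falling (real a) k * real (a - k)"
proof (cases "k \<le> a")
  \<comment> \<open>For \<open>k > a\<close> the truncated last factor is wrong by itself, but the
    product already contains the zero factor at \<open>i = a\<close>.\<close>
  case False
  then have "falling (real a) k = 0" by (auto simp: falling_def)
  then show ?thesis by (simp add: falling_def)
qed (simp add: falling_def of_nat_diff)

lemma falling_eq_fact: "k \<le> a \<Longrightarrow> falling (real a) k = fact a / fact (a - k)"
proof (induction k)
  case 0
  then show ?case by (simp add: falling_def)
next
  case (Suc k)
  then have "fact (a - k) = real (a - k) * (fact (a - Suc k) :: real)"
    by (metis Suc_diff_Suc Suc_le_lessD fact_Suc of_nat_mult)
  moreover have "real (a - k) \<noteq> 0" using Suc.prems by simp
  ultimately show ?case using Suc unfolding falling_Suc_nat by (simp del: of_nat_diff)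
qed

text \<open>The two new factors are the coefficient that a second derivative in coordinate
  \<open>i\<close> produces from the exponent \<open>\<alpha> - \<mu>\<close>.\<close>

lemma mi_falling_add_axis:
  "mi_falling (mi_real \<alpha>) (\<mu> + axis i 2) =
    mi_falling (mi_real \<alpha>) \<mu> * (real ((\<alpha> - \<mu>) $ i) * real ((\<alpha> - \<mu>) $ i - 1))"
proof -
  have "falling (real (\<alpha> $ i)) (\<mu> $ i + 2) =
      falling (real (\<alpha> $ i)) (\<mu> $ i) * (real ((\<alpha> - \<mu>) $ i) * real ((\<alpha> - \<mu>) $ i - 1))"
    by (simp add: numeral_2_eq_2 falling_Suc_nat del: of_nat_diff)
  then show ?thesis
    unfolding mi_falling_def
    by (subst (1 2) prod.remove[of _ i])
      (auto simp: axis_def mi_real_def mult_ac intro!: prod.cong simp del: of_nat_diff)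
qed

lemma mi_falling_eq_0:
  assumes "\<not> \<mu> \<le> \<alpha>"
  shows "mi_falling (mi_real \<alpha>) \<mu> = 0"
proof -
  obtain i where "\<alpha> $ i < \<mu> $ i" using assms by (auto simp: less_eq_vec_def not_le)
  then have "falling (mi_real \<alpha> $ i) (\<mu> $ i) = 0" by (auto simp: falling_def mi_real_def)
  then show ?thesis unfolding mi_falling_def by (intro prod_zero) auto
qed

text \<open>A multinomial expansion of the power of a sum of commuting second derivatives. Where
  \<open>2 * \<delta> \<le> \<alpha>\<close> fails, the falling factorial is 0, so the truncated
  exponent is irrelevant.\<close>

lemma laplacian_power_monomial:
  "(laplacian ^^ j) (\<lambda>y. mi_power y \<alpha>) = (\<lambda>y. \<Sum>\<delta> | mi_size \<delta> = j.
    fact j / mi_fact \<delta> * (mi_falling (mi_real \<alpha>) (2 * \<delta>) * mi_power y (\<alpha> - 2 * \<delta>)))"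
proof (induction j)
  case 0
  have "2 * (0 :: nat ^ 'a) = 0" by (simp add: vec_eq_iff)
  moreover have "mi_falling (mi_real \<alpha>) 0 = 1" by (simp add: mi_falling_def falling_def)
  moreover have "\<alpha> - 0 = \<alpha>" by (simp add: vec_eq_iff)
  ultimately show ?case by (simp add: mi_size_0_iff)
next
  case (Suc j)
  show ?case
  proof
    fix y :: "real ^ 'a"
    have diff: "\<alpha> - (2 * \<delta> + axis i 2) = \<alpha> - 2 * \<delta> - axis i 2" for \<delta> i
      by (simp add: vec_eq_iff)
    have "(laplacian ^^ Suc j) (\<lambda>y. mi_power y \<alpha>) y =
        laplacian (\<lambda>y. \<Sum>\<delta> | mi_size \<delta> = j.
          (fact j / mi_fact \<delta> * mi_falling (mi_real \<alpha>) (2 * \<delta>)) * mi_power y (\<alpha> - 2 * \<delta>)) y"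
      unfolding funpow.simps comp_apply Suc.IH by (simp only: mult.assoc)
    also have "\<dots> = (\<Sum>\<delta> | mi_size \<delta> = j. fact j / mi_fact \<delta> * (\<Sum>i\<in>UNIV.
        mi_falling (mi_real \<alpha>) (2 * (\<delta> + axis i 1)) * mi_power y (\<alpha> - 2 * (\<delta> + axis i 1))))"
      unfolding laplacian_sum_monomials double_add_axis mi_falling_add_axis diff
      by (simp only: sum_distrib_left mult.assoc)
    also have "\<dots> = (\<Sum>\<delta> | mi_size \<delta> = Suc j. fact (Suc j) / mi_fact \<delta> *
        (mi_falling (mi_real \<alpha>) (2 * \<delta>) * mi_power y (\<alpha> - 2 * \<delta>)))"
      by (rule multinomial_step[symmetric])
    finally show "(laplacian ^^ Suc j) (\<lambda>y. mi_power y \<alpha>) y = \<dots>" .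
  qed
qed

text \<open>In each component, \<open>(a - e)! / (a - 2 e)!\<close> times
  \<open>a! / (e! (a - e)!)\<close> loses \<open>(a - e)!\<close>. This links the factors in
  \<open>coeff_c\<close> to those of the iterated Laplacian.\<close>

lemma mi_falling_mult_binomial:
  assumes "2 * \<delta> \<le> \<alpha>"
  shows "mi_falling (mi_real (\<alpha> - \<delta>)) \<delta> * mi_binomial \<alpha> \<delta> = mi_falling (mi_real \<alpha>) (2 * \<delta>) / mi_fact \<delta>"
proof -
  have "falling (real (\<alpha> $ i - \<delta> $ i)) (\<delta> $ i) * real (\<alpha> $ i choose \<delta> $ i) =
      falling (real (\<alpha> $ i)) (2 * \<delta> $ i) / fact (\<delta> $ i)" for i
  proof -
    have "2 * \<delta> $ i \<le> \<alpha> $ i" using assms by (auto simp: less_eq_vec_def)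
    then show ?thesis
      by (simp add: falling_eq_fact binomial_fact mult_2 diff_diff_left del: of_nat_diff)
  qed
  then show ?thesis
    by (simp add: mi_falling_def mi_binomial_def mi_fact_def mi_real_def
        prod.distrib[symmetric] prod_dividef[symmetric] del: of_nat_diff)
qed

section \<open>The projected iterated Laplacian of a monomial\<close>

lemma finite_mi_size_le: "finite {\<mu> :: nat ^ 'n::finite. mi_size \<mu> \<le> m}"
proof -
  have "{\<mu> :: nat ^ 'n. mi_size \<mu> \<le> m} = (\<Union>j\<le>m. {\<mu>. mi_size \<mu> = j})" by auto
  then show ?thesis by simp
qed

lemma mi_size_mono: "\<mu> \<le> \<nu> \<Longrightarrow> mi_size \<mu> \<le> mi_size \<nu>"
  by (auto simp: mi_size_def less_eq_vec_def intro: sum_mono)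

text \<open>Taking sizes gives \<open>2 |\<beta>| \<le> 2 |\<gamma>| - |\<alpha>|\<close>. This
  makes the index set of \<open>coeff_c\<close> finite.\<close>

lemma coeff_c_index_size_le:
  fixes \<gamma> :: "nat ^ 'n::finite"
  assumes "\<gamma> \<le> \<alpha> + \<beta>" "2 * (\<alpha> + \<beta> - \<gamma>) \<le> \<alpha>"
  shows "mi_size \<beta> \<le> mi_size \<gamma>"
  using mi_size_mono[OF assms(1)] mi_size_mono[OF assms(2)] by (simp add: mi_size_diff[OF assms(1)])

lemma finite_coeff_c_index:
  "finite {\<beta> :: nat ^ 'n::finite. \<gamma> \<le> \<alpha> + \<beta> \<and> 2 * (\<alpha> + \<beta> - \<gamma>) \<le> \<alpha>}"
  by (rule finite_subset[OF _ finite_mi_size_le[of "mi_size \<gamma>"]]) (auto intro: coeff_c_index_size_le)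

text \<open>Both sides are one finite double sum: over \<beta> from the norm power and \<delta> from
  the Laplacian power on the left, over \<gamma> and \<beta> on the right, matched by
  \<open>\<gamma> = \<alpha> + \<beta> - \<delta>\<close>.\<close>

lemma harmonic_projection_monomial:
  fixes \<alpha> :: "nat ^ 'n::finite"
  assumes k: "2 * k \<le> mi_size \<alpha>"
  shows "harmonic_projection (mi_size \<alpha> - 2 * k) ((laplacian ^^ k) (\<lambda>y. mi_power y \<alpha>)) y =
    fact k * (\<Sum>\<gamma> | \<alpha> \<le> 2 * \<gamma> \<and> mi_size \<gamma> = mi_size \<alpha> - k.
      coeff_c k \<alpha> \<gamma> * mi_power y (2 * \<gamma> - \<alpha>))"
proof -
  define n where "n = mi_size \<alpha>"
  define M where "M = n div 2 - k"
  define G where "G = {\<gamma>. \<alpha> \<le> 2 * \<gamma> \<and> mi_size \<gamma> = n - k}"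
  define B where "B \<gamma> = {\<beta>. \<gamma> \<le> \<alpha> + \<beta> \<and> 2 * (\<alpha> + \<beta> - \<gamma>) \<le> \<alpha>}" for \<gamma>
  define D where "D \<beta> = {\<delta>. mi_size \<delta> = mi_size \<beta> + k \<and> 2 * \<delta> \<le> \<alpha>}" for \<beta> :: "nat ^ 'n"
  define S where "S = {\<beta> :: nat ^ 'n. mi_size \<beta> \<le> M}"
  \<comment> \<open>\<open>T\<close> is the summand of the projection with
    \<open>b = mi_size \<beta>\<close>; \<open>U\<close> below is the summand of
    \<open>coeff_c\<close>.\<close>
  define T where "T \<beta> \<delta> = (- 1 / 2) ^ mi_size \<beta> / fact (mi_size \<beta>) * q_prod CARD('n) k n (mi_size \<beta>) *
    (fact (mi_size \<beta>) / mi_fact \<beta> * mi_power y (2 * \<beta>)) *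
    (fact (mi_size \<beta> + k) / mi_fact \<delta> * (mi_falling (mi_real \<alpha>) (2 * \<delta>) * mi_power y (\<alpha> - 2 * \<delta>)))"
    for \<beta> \<delta> :: "nat ^ 'n"
  define U where "U \<gamma> \<beta> = (- 2) powi (- int (mi_size \<beta>))
        * mi_falling (mi_real \<gamma> - mi_real \<beta>) (\<alpha> + \<beta> - \<gamma>)
        * q_prod CARD('n) k n (mi_size \<beta>)
        * (fact (mi_size \<beta>) / mi_fact \<beta>)
        * real ((mi_size \<beta> + k) choose k)
        * mi_binomial \<alpha> (\<alpha> + \<beta> - \<gamma>)" for \<gamma> \<beta>
  have fin: "finite G" "finite S" "finite (B \<gamma>)" "finite (D \<beta>)" for \<gamma> \<beta>
    unfolding G_def S_def B_def D_def
    by (auto intro: finite_subset[OF _ finite_mi_size] finite_mi_size_le finite_coeff_c_index)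
  have M: "(n - 2 * k) div 2 = M" unfolding M_def by simp
  have lap: "(laplacian ^^ b) ((laplacian ^^ k) f) = (laplacian ^^ (b + k)) f" for b and f :: "real ^ 'n \<Rightarrow> real"
    by (simp add: funpow_add)
  have "harmonic_projection (n - 2 * k) ((laplacian ^^ k) (\<lambda>y. mi_power y \<alpha>)) y =
      (\<Sum>b\<le>M. \<Sum>\<beta> | \<beta> \<in> S \<and> mi_size \<beta> = b. \<Sum>\<delta>\<in>D \<beta>. T \<beta> \<delta>)"
    unfolding harmonic_projection_def M
  proof (intro sum.cong refl)
    fix b assume b: "b \<in> {..M}"
    define c where "c = (- 1 / 2) ^ b / fact b * q_prod CARD('n) k n b"
    have "norm y ^ (2 * b) * (laplacian ^^ (b + k)) (\<lambda>y. mi_power y \<alpha>) y =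
        (\<Sum>\<beta> | mi_size \<beta> = b. \<Sum>\<delta> | mi_size \<delta> = b + k. (fact b / mi_fact \<beta> * mi_power y (2 * \<beta>)) *
          (fact (b + k) / mi_fact \<delta> * (mi_falling (mi_real \<alpha>) (2 * \<delta>) * mi_power y (\<alpha> - 2 * \<delta>))))"
      unfolding norm_power_multinomial laplacian_power_monomial sum_product ..
    then have "c * (norm y ^ (2 * b) * (laplacian ^^ (b + k)) (\<lambda>y. mi_power y \<alpha>) y) =
        (\<Sum>\<beta> | mi_size \<beta> = b. \<Sum>\<delta> | mi_size \<delta> = mi_size \<beta> + k. T \<beta> \<delta>)"
      by (simp add: T_def c_def sum_distrib_left mult.assoc)
    \<comment> \<open>Indices \<delta> violating \<open>2 * \<delta> \<le> \<alpha>\<close>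
      contribute 0 and are dropped, so that the substitution becomes a bijection.\<close>
    also have "\<dots> = (\<Sum>\<beta> | \<beta> \<in> S \<and> mi_size \<beta> = b. \<Sum>\<delta>\<in>D \<beta>. T \<beta> \<delta>)"
    proof (rule sum.cong)
      show "{\<beta>. mi_size \<beta> = b} = {\<beta>. \<beta> \<in> S \<and> mi_size \<beta> = b}" using b by (auto simp: S_def)
      show "(\<Sum>\<delta> | mi_size \<delta> = mi_size \<beta> + k. T \<beta> \<delta>) = (\<Sum>\<delta>\<in>D \<beta>. T \<beta> \<delta>)" for \<beta>
        by (rule sum.mono_neutral_right) (auto simp: D_def T_def mi_falling_eq_0)
    qed
    finally show "(- 1 / 2) ^ b / fact b * q_prod CARD('n) 0 (n - 2 * k) b *
        (norm y ^ (2 * b) * (laplacian ^^ b) ((laplacian ^^ k) (\<lambda>y. mi_power y \<alpha>)) y) =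
        (\<Sum>\<beta> | \<beta> \<in> S \<and> mi_size \<beta> = b. \<Sum>\<delta>\<in>D \<beta>. T \<beta> \<delta>)"
      unfolding c_def lap using q_prod_shift[of k n] k by (simp add: n_def)
  qed
  also have "\<dots> = (\<Sum>\<beta>\<in>S. \<Sum>\<delta>\<in>D \<beta>. T \<beta> \<delta>)"
    by (rule sum.group) (auto simp: fin, auto simp: S_def)
  also have "\<dots> = (\<Sum>(\<beta>, \<delta>)\<in>Sigma S D. T \<beta> \<delta>)"
    by (rule sum.Sigma) (auto simp: fin)
  also have "\<dots> = (\<Sum>(\<gamma>, \<beta>)\<in>Sigma G B. fact k * (U \<gamma> \<beta> * mi_power y (2 * \<gamma> - \<alpha>)))"
  proof (rule sum.reindex_bij_witness[of _ "\<lambda>(\<gamma>, \<beta>). (\<beta>, \<alpha> + \<beta> - \<gamma>)" "\<lambda>(\<beta>, \<delta>). (\<alpha> + \<beta> - \<delta>, \<beta>)"])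
    fix p assume "p \<in> Sigma G B"
    then obtain \<gamma> \<beta> where p: "p = (\<gamma>, \<beta>)" "\<alpha> \<le> 2 * \<gamma>" "mi_size \<gamma> = n - k"
      "\<gamma> \<le> \<alpha> + \<beta>" "2 * (\<alpha> + \<beta> - \<gamma>) \<le> \<alpha>"
      by (auto simp: G_def B_def)
    have "\<alpha> + \<beta> - (\<alpha> + \<beta> - \<gamma>) = \<gamma>" using p(4) by (auto simp: vec_eq_iff less_eq_vec_def)
    then show "(case case p of (\<gamma>, \<beta>) \<Rightarrow> (\<beta>, \<alpha> + \<beta> - \<gamma>) of (\<beta>, \<delta>) \<Rightarrow> (\<alpha> + \<beta> - \<delta>, \<beta>)) = p"
      by (simp add: p(1))
    have sz: "mi_size (\<alpha> + \<beta> - \<gamma>) = mi_size \<beta> + k"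
      using mi_size_diff[OF p(4)] p(3) k by (simp add: n_def)
    \<comment> \<open>This is the bound \<open>mi_size \<beta> \<le> M\<close> that puts \<beta>
      into \<open>S\<close>.\<close>
    with mi_size_mono[OF p(5)] have "2 * (mi_size \<beta> + k) \<le> n" by (simp add: n_def)
    then show "(case p of (\<gamma>, \<beta>) \<Rightarrow> (\<beta>, \<alpha> + \<beta> - \<gamma>)) \<in> Sigma S D"
      using p sz by (auto simp: S_def D_def M_def)
  next
    fix p assume "p \<in> Sigma S D"
    then obtain \<beta> \<delta> where p: "p = (\<beta>, \<delta>)" "mi_size \<delta> = mi_size \<beta> + k" "2 * \<delta> \<le> \<alpha>"
      by (auto simp: S_def D_def)
    have le: "2 * \<delta> $ i \<le> \<alpha> $ i" for i using p(3) by (auto simp: less_eq_vec_def)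
    have le': "\<delta> $ i \<le> \<alpha> $ i" for i using le[of i] by simp
    have \<delta>: "\<delta> \<le> \<alpha> + \<beta>" using le' by (auto simp: less_eq_vec_def intro: trans_le_add1)
    have inv: "\<alpha> + \<beta> - (\<alpha> + \<beta> - \<delta>) = \<delta>" using \<delta> by (auto simp: vec_eq_iff less_eq_vec_def)
    then show "(case case p of (\<beta>, \<delta>) \<Rightarrow> (\<alpha> + \<beta> - \<delta>, \<beta>) of (\<gamma>, \<beta>) \<Rightarrow> (\<beta>, \<alpha> + \<beta> - \<gamma>)) = p"
      by (simp add: p(1))
    have "\<alpha> \<le> 2 * (\<alpha> + \<beta> - \<delta>)"
      unfolding less_eq_vec_def
    proof
      show "\<alpha> $ i \<le> (2 * (\<alpha> + \<beta> - \<delta>)) $ i" for i using le[of i] by simp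
    qed
    moreover have "mi_size (\<alpha> + \<beta> - \<delta>) = n - k" using mi_size_diff[OF \<delta>] p(2) by (simp add: n_def)
    moreover have "\<alpha> + \<beta> - \<delta> \<le> \<alpha> + \<beta>" by (simp add: less_eq_vec_def)
    ultimately show "(case p of (\<beta>, \<delta>) \<Rightarrow> (\<alpha> + \<beta> - \<delta>, \<beta>)) \<in> Sigma G B"
      using p inv by (simp add: G_def B_def)
    \<comment> \<open>Under the substitution \<open>\<gamma> - \<beta>\<close> becomes
      \<open>\<alpha> - \<delta>\<close> and \<open>2 \<gamma> - \<alpha>\<close> becomes
      \<open>2 \<beta> + (\<alpha> - 2 \<delta>)\<close>; by
      \<open>2 * \<delta> \<le> \<alpha>\<close> no subtraction truncates.\<close>
    have "mi_real (\<alpha> + \<beta> - \<delta>) - mi_real \<beta> = mi_real (\<alpha> - \<delta>)"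
      using le' by (simp add: vec_eq_iff mi_real_def of_nat_diff trans_le_add1)
    moreover have "2 * (\<alpha> + \<beta> - \<delta>) - \<alpha> = 2 * \<beta> + (\<alpha> - 2 * \<delta>)"
      unfolding vec_eq_iff
    proof
      show "(2 * (\<alpha> + \<beta> - \<delta>) - \<alpha>) $ i = (2 * \<beta> + (\<alpha> - 2 * \<delta>)) $ i" for i using le[of i] by simp
    qed
    moreover have "(- 2 :: real) powi (- int b) = (- 1 / 2) ^ b" for b
      by (simp add: power_int_minus power_inverse[symmetric])
    ultimately have "fact k * (U (\<alpha> + \<beta> - \<delta>) \<beta> * mi_power y (2 * (\<alpha> + \<beta> - \<delta>) - \<alpha>)) =
        fact k * (- 1 / 2) ^ mi_size \<beta> * q_prod CARD('n) k n (mi_size \<beta>) * (fact (mi_size \<beta>) / mi_fact \<beta>)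
          * real ((mi_size \<beta> + k) choose k) * (mi_falling (mi_real (\<alpha> - \<delta>)) \<delta> * mi_binomial \<alpha> \<delta>)
          * (mi_power y (2 * \<beta>) * mi_power y (\<alpha> - 2 * \<delta>))"
      unfolding U_def inv by (simp only: mi_power_add mult_ac)
    \<comment> \<open>The global factor \<open>k!\<close> arises from
      \<open>k! binom(|\<beta>| + k, k) = (|\<beta>| + k)! / |\<beta>|!\<close>.\<close>
    also have "\<dots> = T \<beta> \<delta>"
      unfolding mi_falling_mult_binomial[OF p(3)] T_def
      by (simp add: binomial_fact)
    finally show "(case (case p of (\<beta>, \<delta>) \<Rightarrow> (\<alpha> + \<beta> - \<delta>, \<beta>)) of (\<gamma>, \<beta>) \<Rightarrow>
        fact k * (U \<gamma> \<beta> * mi_power y (2 * \<gamma> - \<alpha>))) = (case p of (\<beta>, \<delta>) \<Rightarrow> T \<beta> \<delta>)"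
      by (simp add: p(1))
  qed
  also have "\<dots> = (\<Sum>\<gamma>\<in>G. \<Sum>\<beta>\<in>B \<gamma>. fact k * (U \<gamma> \<beta> * mi_power y (2 * \<gamma> - \<alpha>)))"
    by (rule sum.Sigma[symmetric]) (auto simp: fin)
  also have "\<dots> = fact k * (\<Sum>\<gamma>\<in>G. coeff_c k \<alpha> \<gamma> * mi_power y (2 * \<gamma> - \<alpha>))"
    unfolding coeff_c_def B_def[symmetric] n_def[symmetric] U_def[symmetric]
    by (simp only: sum_distrib_left sum_distrib_right)
  finally show ?thesis unfolding n_def G_def .
qed

subsection \<open>Dyadic coefficients\<close>

lemma dyadic_rational_Ints: "x \<in> \<int> \<Longrightarrow> dyadic_rational x"
  unfolding dyadic_rational_def by (elim Ints_cases) (metis div_by_1 power_0)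

lemma dyadic_rational_add:
  assumes "dyadic_rational x" "dyadic_rational y"
  shows "dyadic_rational (x + y)"
proof -
  obtain a b c d where "x = of_int a / 2 ^ b" "y = of_int c / 2 ^ d"
    using assms unfolding dyadic_rational_def by blast
  then have "x + y = of_int (a * 2 ^ d + c * 2 ^ b) / 2 ^ (b + d)"
    by (simp add: add_frac_eq power_add)
  then show ?thesis unfolding dyadic_rational_def by blast
qed

lemma dyadic_rational_mult:
  assumes "dyadic_rational x" "dyadic_rational y"
  shows "dyadic_rational (x * y)"
proof -
  obtain a b c d where "x = of_int a / 2 ^ b" "y = of_int c / 2 ^ d"
    using assms unfolding dyadic_rational_def by blast
  then have "x * y = of_int (a * c) / 2 ^ (b + d)"
    by (simp add: power_add)
  then show ?thesis unfolding dyadic_rational_def by blast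
qed

lemma dyadic_rational_sum:
  assumes "\<And>i. i \<in> A \<Longrightarrow> dyadic_rational (f i)"
  shows "dyadic_rational (sum f A)"
  using assms
  by (induction A rule: infinite_finite_induct)
    (auto intro: dyadic_rational_add dyadic_rational_Ints)

text \<open>Integrality of multinomial coefficients, reduced by induction on the index set to that
  of binomial coefficients.\<close>

lemma prod_fact_dvd_fact_sum:
  "(\<Prod>i\<in>A. fact (f i)) dvd (fact (\<Sum>i\<in>A. f i) :: nat)"
proof (induction A rule: infinite_finite_induct)
  case (insert i A)
  have "fact (f i) * (\<Prod>i\<in>A. fact (f i)) dvd fact (f i) * (fact (\<Sum>i\<in>A. f i) :: nat)"
    using insert.IH by (rule mult_dvd_mono[OF dvd_refl])
  also have "\<dots> dvd fact (f i + (\<Sum>i\<in>A. f i))" by (rule fact_fact_dvd_fact)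
  finally show ?case using insert.hyps by simp
qed simp_all

lemma multinomial_Ints: "fact (mi_size \<beta>) / mi_fact \<beta> \<in> \<int>"
proof -
  obtain c where "fact (mi_size \<beta>) = (\<Prod>i\<in>UNIV. fact (\<beta> $ i)) * (c :: nat)"
    using prod_fact_dvd_fact_sum[of "\<lambda>i. \<beta> $ i" UNIV] unfolding mi_size_def by (elim dvdE)
  then have "real (fact (mi_size \<beta>)) = real ((\<Prod>i\<in>UNIV. fact (\<beta> $ i)) * c)" by (rule arg_cong)
  then have "fact (mi_size \<beta>) = mi_fact \<beta> * real c" by (simp add: mi_fact_def)
  moreover have "mi_fact \<beta> \<noteq> 0" by (simp add: mi_fact_def)
  ultimately show ?thesis by simp
qed

text \<open>In each summand every factor except the power of -2 is an integer, and dyadic rationals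
  are closed under sums and products.\<close>

lemma dyadic_rational_coeff_c: "dyadic_rational (coeff_c k \<alpha> \<gamma>)"
proof -
  have "mi_falling (mi_real \<gamma> - mi_real \<beta>) \<mu> \<in> \<int>" for \<beta> \<mu> :: "nat ^ 'a"
    unfolding mi_falling_def falling_def mi_real_def by (auto intro!: Ints_prod)
  moreover have "q_prod d k n m \<in> \<int>" for d n m
    unfolding q_prod_def by (intro Ints_prod) auto
  moreover have "mi_binomial \<alpha> \<mu> \<in> \<int>" for \<mu>
    unfolding mi_binomial_def by (intro Ints_prod) auto
  moreover have "dyadic_rational ((- 2) powi (- int b))" for b
  proof -
    have "(- 2 :: real) powi (- int b) = of_int ((- 1) ^ b) / 2 ^ b"
      by (simp add: power_int_minus power_minus[of 2] field_simps)
    then show ?thesis unfolding dyadic_rational_def by blast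
  qed
  ultimately show ?thesis
    unfolding coeff_c_def
    by (intro dyadic_rational_sum dyadic_rational_mult) (auto intro: dyadic_rational_Ints multinomial_Ints)
qed

subsection \<open>The representation formula\<close>

text \<open>The projection of \<open>\<Delta>^k y^\<alpha>\<close> is evaluated twice, from the
  decomposition and from the monomial expansion. Cancelling \<open>k!\<close> and dividing by the
  positive constants leaves \<open>omega\<close>.\<close>

lemma harmonic_decomposition_formula:
  fixes \<alpha> :: "nat ^ 'n::finite"
  assumes "harmonic_decomposition \<alpha> h" and k: "2 * k \<le> mi_size \<alpha>"
  shows "h k y = omega CARD('n) k (mi_size \<alpha>) *
    (\<Sum>\<gamma> | \<alpha> \<le> 2 * \<gamma> \<and> mi_size \<gamma> = mi_size \<alpha> - k. coeff_c k \<alpha> \<gamma> * mi_power y (2 * \<gamma> - \<alpha>))"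
proof -
  define P where "P = (\<Prod>j = 1..k. 2 * real (mi_size \<alpha>) + real CARD('n) - 2 * real k - 2 * real j)"
  define q where "q = q_prod CARD('n) k (mi_size \<alpha>) 0"
  define s where "s = (\<Sum>\<gamma> | \<alpha> \<le> 2 * \<gamma> \<and> mi_size \<gamma> = mi_size \<alpha> - k. coeff_c k \<alpha> \<gamma> * mi_power y (2 * \<gamma> - \<alpha>))"
  \<comment> \<open>As \<open>j \<le> k\<close>, one has
    \<open>2 k + 2 j \<le> 4 k \<le> 2 n < 2 n + d\<close> with
    \<open>n = mi_size \<alpha>\<close>.\<close>
  have "P > 0" unfolding P_def
  proof (intro prod_pos ballI)
    fix j assume "j \<in> {1..k}"
    then have "2 * k + 2 * j < 2 * mi_size \<alpha> + CARD('n)" using k zero_less_card_finite[where 'a='n] by (simp only: atLeastAtMost_iff) linarith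
    then have "real (2 * k + 2 * j) < real (2 * mi_size \<alpha> + CARD('n))" by (subst of_nat_less_iff)
    then show "0 < 2 * real (mi_size \<alpha>) + real CARD('n) - 2 * real k - 2 * real j" by simp
  qed
  moreover have "q > 0" unfolding q_def using k by (rule q_prod_pos) simp
  moreover have "2 ^ k * fact k * P * q * h k y = fact k * s"
    using harmonic_projection_laplacian_power[of "mi_size \<alpha>" h "\<lambda>y. mi_power y \<alpha>" k y]
      harmonic_projection_monomial[OF k, of y] assms
    unfolding harmonic_decomposition_def is_harmonic_iff P_def q_def s_def by simp
  ultimately have "h k y = 1 / (2 ^ k * q * P) * s" by (simp add: field_simps)
  then show ?thesis unfolding omega_def P_def q_def s_def .
qed

text \<open>A decomposition is unconstrained at indices with
  \<open>2 * k > mi_size \<alpha>\<close>; \<open>extensional\<close> fixes the value there to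
  \<open>undefined\<close>, so that unique existence holds for the whole family.\<close>

theorem theorem4p1:
  fixes \<alpha> :: "nat ^ 'n::finite"
  shows "(\<exists>!h. h \<in> extensional {k. 2 * k \<le> mi_size \<alpha>} \<and> harmonic_decomposition \<alpha> h) \<and>
    (\<forall>h. harmonic_decomposition \<alpha> h \<longrightarrow>
      (\<forall>k. 2 * k \<le> mi_size \<alpha> \<longrightarrow>
        (\<forall>y :: real ^ 'n. h k y =
           omega CARD('n) k (mi_size \<alpha>) *
           (\<Sum>\<gamma> | \<alpha> \<le> 2 * \<gamma> \<and> mi_size \<gamma> = mi_size \<alpha> - k.
              coeff_c k \<alpha> \<gamma> * mi_power y (2 * \<gamma> - \<alpha>))))) \<and>
    (\<forall>k \<gamma>. 2 * k \<le> mi_size \<alpha> \<and> \<alpha> \<le> 2 * \<gamma> \<and> mi_size \<gamma> = mi_size \<alpha> - k \<longrightarrow>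
       dyadic_rational (coeff_c k \<alpha> \<gamma>))"
proof (intro conjI)
  let ?K = "{k. 2 * k \<le> mi_size \<alpha>}"
  show "\<exists>!h. h \<in> extensional ?K \<and> harmonic_decomposition \<alpha> h"
  proof (rule ex_ex1I)
    obtain h where h: "\<And>k. 2 * k \<le> mi_size \<alpha> \<Longrightarrow> homogeneous_polynomial (mi_size \<alpha> - 2 * k) (h k)"
      "\<And>k. 2 * k \<le> mi_size \<alpha> \<Longrightarrow> laplacian (h k) = (\<lambda>_. 0)"
      "\<And>y. mi_power y \<alpha> = (\<Sum>k = 0..mi_size \<alpha> div 2. norm y ^ (2 * k) * h k y)"
      using homogeneous_polynomial_decomposition[OF homogeneous_polynomial_monomial[OF refl]] by blast
    \<comment> \<open>Restriction changes nothing in the sum, whose indices all lie in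
      \<open>?K\<close>.\<close>
    have "(\<Sum>k = 0..mi_size \<alpha> div 2. norm y ^ (2 * k) * h k y) =
        (\<Sum>k = 0..mi_size \<alpha> div 2. norm y ^ (2 * k) * restrict h ?K k y)" for y
      by (intro sum.cong) auto
    with h have "harmonic_decomposition \<alpha> (restrict h ?K)"
      unfolding harmonic_decomposition_def is_harmonic_iff by simp
    then show "\<exists>h. h \<in> extensional ?K \<and> harmonic_decomposition \<alpha> h"
      using restrict_extensional by blast
  next
    fix h h' assume "h \<in> extensional ?K \<and> harmonic_decomposition \<alpha> h"
      and "h' \<in> extensional ?K \<and> harmonic_decomposition \<alpha> h'"
    \<comment> \<open>Uniqueness: the formula determines every value on \<open>?K\<close>, and
      extensionality every other one.\<close>
    then show "h = h'"
      by (intro extensionalityI[of h ?K h']) (auto simp: harmonic_decomposition_formula)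
  qed
qed (auto intro: harmonic_decomposition_formula dyadic_rational_coeff_c)

end
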